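(* Let, for some $\mu\ge0$, the prior distribution $\pi$ of the change point belong to the class $\mathbf C(\mu)$. Assume that for some positive and finite numbers $I_i(\theta_i)$ ($\theta_i\in\Theta_i$, $i\in\mathcal N$) and $I_{ij}(\theta_i,\theta_j)$ ($\theta_i\in\Theta_i$, $\theta_j\in\Theta_j$, $i\in\mathcal N$, $j\in\mathcal N\setminus\{i\}$) condition $\mathbf C_1$ holds. If $\inf_{\theta_j\in\Theta_j}I_{ij}(\theta_i,\theta_j)>0$ for all $j\in\mathcal N\setminus\{i\}$, then for all $r>0$, $\theta_i\in\Theta_i$ and $i\in\mathcal N$, $$\liminf_{\alpha_{\max},\beta_{\max}\to0}\frac{\inf_{\delta\in\mathbb C_\pi(\boldsymbol\alpha,\boldsymbol\beta)}\mathcal R^r_{k,i,\theta_i}(\delta)}{[\Psi_i(\boldsymbol\alpha,\boldsymbol\beta)]^r}\ge1\quad\text{for all }k\in\{-1,0,1,\dots\},$$ $$\liminf_{\alpha_{\max},\beta_{\max}\to0}\frac{\inf_{\delta\in\mathbb C_\pi(\boldsymbol\alpha,\boldsymbol\beta)}\bar{\mathcal R}^r_{i,\theta_i}(\delta)}{[\Psi_i(\boldsymbol\alpha,\boldsymbol\beta)]^r}\ge1,$$ and $$\liminf_{\alpha,\bar\beta_{\max}\to0}\frac{\inf_{\delta\in\mathbb C^\star_\pi(\alpha,\bar{\boldsymbol\beta})}\mathcal R^r_{k,i,\theta_i}(\delta)}{[\Psi^\star_i(\alpha,\bar{\boldsymbol\beta})]^r}\ge1\quad\text{for all }k\in\{-1,0,1,\dots\},$$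 $$\liminf_{\alpha,\bar\beta_{\max}\to0}\frac{\inf_{\delta\in\mathbb C^\star_\pi(\alpha,\bar{\boldsymbol\beta})}\bar{\mathcal R}^r_{i,\theta_i}(\delta)}{[\Psi^\star_i(\alpha,\bar{\boldsymbol\beta})]^r}\ge1,$$ where $$\Psi_i(\boldsymbol\alpha,\boldsymbol\beta)=\max\Big\{\frac{|\log\alpha_i|}{I_i(\theta_i)+\mu},\ \max_{j\in\mathcal N\setminus\{i\}}\frac{|\log\beta_{ji}|}{\inf_{\theta_j\in\Theta_j}I_{ij}(\theta_i,\theta_j)}\Big\},$$ $$\Psi^\star_i(\alpha,\bar{\boldsymbol\beta})=\max\Big\{\frac{|\log\alpha|}{I_i(\theta_i)+\mu},\ \max_{j\in\mathcal N\setminus\{i\}}\frac{|\log\bar\beta_j|}{\inf_{\theta_j\in\Theta_j}I_{ij}(\theta_i,\theta_j)}\Big\}.$$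
   Context: Model. $N\ge2$, $\mathcal N=\{1,\dots,N\}$, $\mathcal N_0=\{0,1,\dots,N\}$. There are $N$ independent data streams $\{X_n(i)\}_{n\ge1}$, $i\in\mathcal N$; $\mathbf X^n(i)=(X_1(i),\dots,X_n(i))$, $\mathbf X^n=(\mathbf X^n(1),\dots,\mathbf X^n(N))$, $\mathcal F_n=\sigma(\mathbf X^n)$. For each stream $i$, $g_i(X_t(i)|\mathbf X^{t-1}(i))$ and $f_{i,\theta_i}(X_t(i)|\mathbf X^{t-1}(i))$, $\theta_i\in\Theta_i$, are conditional pre- and post-change densities with respect to a sigma-finite measure. Under $\mathsf P_\infty$ (no change) $\mathbf X^n$ has density $\prod_{t=1}^n\prod_{\ell=1}^N g_\ell(X_t(\ell)|\mathbf X^{t-1}(\ell))$ for all $n$. Under $\mathsf P_{k,i,\theta_i}$ (change at $\nu=k$ in stream $i$ with parameter $\theta_i$; expectation $\mathsf E_{k,i,\theta_i}$), the density of $\mathbf X^n$ is the same as under $\mathsf P_\infty$ for $k\ge n$, and for $k<n$ it is $$\prod_{t=1}^{k}g_i(X_t(i)|\mathbf X^{t-1}(i))\prod_{t=k+1}^n f_{i,\theta_i}(X_t(i)|\mathbf X^{t-1}(i))\prod_{j\in\mathcal N\setminus\{i\}}\prod_{t=1}^n g_j(X_t(j)|\mathbf X^{t-1}(j));$$ $\mathsf P_{-1,i,\theta_i}$ coincides with $\mathsf P_{0,i,\theta_i}$. Prior. The change point $\nu$ takes values in $\{-1,0,1,\dots\}$, independently of the observations, with $\pi_k=\mathsf P(\nu=k)$,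 $\pi_k>0$ for $k\ge0$, $\pi_{-1}\in[0,1)$, $\sum_{k\ge-1}\pi_k=1$. Put $\mathsf P^\pi_{i,\theta_i}(\mathcal A\times\mathcal K)=\sum_{k\in\mathcal K}\pi_k\mathsf P_{k,i,\theta_i}(\mathcal A)$, with expectation $\mathsf E^\pi_{i,\theta_i}$. The class $\mathbf C(\mu)$, $0\le\mu<\infty$, consists of such priors satisfying $\lim_{n\to\infty}\frac1n\big|\log\sum_{k=n+1}^\infty\pi_k\big|=\mu$ and, if $\mu=0$, in addition $\sum_{k=0}^\infty\pi_k|\log\pi_k|^{r'}<\infty$ for some $r'\ge1$. Rules and error probabilities. A detection--identification rule is a pair $\delta=(d,T)$, $T$ a stopping time with respect to $\{\mathcal F_n\}_{n\ge0}$ and $d\in\mathcal N$ a decision made at time $T$ (which stream has changed). $\mathsf{PFA}^\pi(\delta)=\sum_{k=0}^\infty\pi_k\mathsf P_\infty(T\le k)$; $\mathsf{PFA}_i^\pi(\delta)=\sum_{k=0}^\infty\pi_k\mathsf P_\infty(T\le k,\,d=i)$; $\mathsf{PMI}_{ij}^\pi(\delta)=\sup_{\theta_i\in\Theta_i}\mathsf P^\pi_{i,\theta_i}(d=j,\,T<\infty\,|\,T>\nu)$ for $i\ne j$ in $\mathcal N$; $\mathsf{PMI}_i^\pi(\delta)=\sup_{\theta_i\in\Theta_i}\mathsf P^\pi_{i,\theta_i}(d\ne i,\,T<\infty\,|\,T>\nu)$. Classes. For $\boldsymbol\alpha=(\alpha_i)_{i\in\mathcal N}$, $\boldsymbol\beta=(\beta_{ij})_{i\neq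 j}$, $\bar{\boldsymbol\beta}=(\bar\beta_i)_{i\in\mathcal N}$ and $\alpha$, all entries in $(0,1)$: $\mathbb C_\pi(\boldsymbol\alpha,\boldsymbol\beta)=\{\delta:\mathsf{PFA}_i^\pi(\delta)\le\alpha_i\ \forall i\in\mathcal N,\ \mathsf{PMI}_{ij}^\pi(\delta)\le\beta_{ij}\ \forall i\ne j\in\mathcal N\}$, $\mathbb C_\pi^\star(\alpha,\bar{\boldsymbol\beta})=\{\delta:\mathsf{PFA}^\pi(\delta)\le\alpha,\ \mathsf{PMI}_i^\pi(\delta)\le\bar\beta_i\ \forall i\in\mathcal N\}$. Also $\alpha_{\max}=\max_i\alpha_i$, $\beta_{\max}=\max_{i\ne j}\beta_{ij}$, $\bar\beta_{\max}=\max_i\bar\beta_i$. Risks. For $k\in\{-1,0,1,\dots\}$, $\mathcal R^r_{k,i,\theta_i}(\delta)=\mathsf E_{k,i,\theta_i}[(T-k)^r;\,d=i\,|\,T>k]$, i.e. $\mathsf E_{k,i,\theta_i}[(T-k)^r\mathbf 1\{d=i,T>k\}]/\mathsf P_{k,i,\theta_i}(T>k)$; and $\bar{\mathcal R}^r_{i,\theta_i}(\delta)=\mathsf E^\pi_{i,\theta_i}[(T-\nu)^r;\,d=i\,|\,T>\nu]=\sum_{k=-1}^\infty\pi_k\mathsf E_{k,i,\theta_i}[(T-k)^r\mathbf 1\{d=i,T>k\}]\big/(1-\mathsf{PFA}^\pi(\delta))$. Convention: for $k=-1$ (or $\nu=-1$), $T-k$ is replaced by $T$. Log-likelihood ratios.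 $\lambda_{i,\theta_i}(k,k+n)=\sum_{t=k+1}^{k+n}\log\frac{f_{i,\theta_i}(X_t(i)|\mathbf X^{t-1}(i))}{g_i(X_t(i)|\mathbf X^{t-1}(i))}$; for $j\in\mathcal N\setminus\{i\}$, $\lambda_{i,\theta_i;j,\theta_j}(k,k+n)=\lambda_{i,\theta_i}(k,k+n)-\lambda_{j,\theta_j}(k,k+n)$; for $j=0$, $\lambda_{i,\theta_i;0,\theta_0}=\lambda_{i,\theta_i}$ and $I_{i0}(\theta_i,\theta_0)=I_i(\theta_i)$ (with $\theta_0$ a dummy symbol). Condition $\mathbf C_1$ (for the given numbers $I_i$, $I_{ij}$): for any $\varepsilon>0$, all $k\in\{0,1,2,\dots\}$, $i\in\mathcal N$, $j\in\mathcal N_0\setminus\{i\}$, $\theta_i\in\Theta_i$, $\theta_j\in\Theta_j$, $$\lim_{M\to\infty}\mathsf P_{k,i,\theta_i}\Big\{\frac1M\max_{1\le n\le M}\lambda_{i,\theta_i;j,\theta_j}(k,k+n)\ge(1+\varepsilon)I_{ij}(\theta_i,\theta_j)\Big\}=0.$$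
   Formalization: On the event T = ∞ the loss (T−k)^r 1{d=i} is taken to be infinite for every i, whatever d is; otherwise the rule that never stops (T = ∞, d = 2) meets all error constraints with zero risk for i = 1. *)

theory Defs
  imports "HOL-Probability.Probability" "HOL-Library.Extended_Nat"
begin

section \<open>The multistream change point model\<close>

text \<open>
  Streams carry the labels \<open>1, \<dots>, streams M\<close> and time starts at \<open>1\<close>.
  \<open>pre M i t h y\<close> stands for \<open>g_i(y | h)\<close> and \<open>post M i \<theta> t h y\<close> for \<open>f_{i,\<theta>}(y | h)\<close>, where \<open>h\<close> is
  the history of stream \<open>i\<close> at times \<open>1, \<dots>, t - 1\<close>, a function on \<open>{1..<t}\<close>.
  \<open>obs M t i\<close> is the observation \<open>X_t(i)\<close>, \<open>Pinf M\<close> the law without a change, and \<open>Pchg M k i \<theta>\<close>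
  the law with a change at \<open>k\<close> (\<open>k = -1, 0, 1, \<dots>\<close>) in stream \<open>i\<close> with parameter \<open>\<theta>\<close>.
\<close>

record ('w, 'a, 'p) multistream =
  streams :: nat
  base :: "nat \<Rightarrow> 'a measure"
  pre :: "nat \<Rightarrow> nat \<Rightarrow> (nat \<Rightarrow> 'a) \<Rightarrow> 'a \<Rightarrow> real"
  param :: "nat \<Rightarrow> 'p set"
  post :: "nat \<Rightarrow> 'p \<Rightarrow> nat \<Rightarrow> (nat \<Rightarrow> 'a) \<Rightarrow> 'a \<Rightarrow> real"
  obs :: "nat \<Rightarrow> nat \<Rightarrow> 'w \<Rightarrow> 'a"
  Pinf :: "'w measure"
  Pchg :: "int \<Rightarrow> nat \<Rightarrow> 'p \<Rightarrow> 'w measure"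

definition cond_density :: "'a measure \<Rightarrow> nat \<Rightarrow> ((nat \<Rightarrow> 'a) \<Rightarrow> 'a \<Rightarrow> real) \<Rightarrow> bool" where
  "cond_density m t q \<longleftrightarrow>
     (\<lambda>(h, y). q h y) \<in> borel_measurable (PiM {1..<t} (\<lambda>_. m) \<Otimes>\<^sub>M m) \<and>
     (\<forall>h \<in> space (PiM {1..<t} (\<lambda>_. m)).
        (\<forall>y \<in> space m. 0 \<le> q h y) \<and> (\<integral>\<^sup>+ y. ennreal (q h y) \<partial>m) = 1)"

definition sample_idx :: "('w, 'a, 'p) multistream \<Rightarrow> enat \<Rightarrow> (nat \<times> nat) set" where
  "sample_idx M n = {(t, l). 1 \<le> t \<and> enat t \<le> n \<and> l \<in> {1..streams M}}"

definition sample_base :: "('w, 'a, 'p) multistream \<Rightarrow> enat \<Rightarrow> (nat \<times> nat \<Rightarrow> 'a) measure" where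
  "sample_base M n = PiM (sample_idx M n) (\<lambda>(t, l). base M l)"

definition sample :: "('w, 'a, 'p) multistream \<Rightarrow> enat \<Rightarrow> 'w \<Rightarrow> nat \<times> nat \<Rightarrow> 'a" where
  "sample M n \<omega> = (\<lambda>(t, l) \<in> sample_idx M n. obs M t l \<omega>)"

definition stream_hist :: "(nat \<times> nat \<Rightarrow> 'a) \<Rightarrow> nat \<Rightarrow> nat \<Rightarrow> nat \<Rightarrow> 'a" where
  "stream_hist x l t = (\<lambda>s \<in> {1..<t}. x (s, l))"

definition dens_inf :: "('w, 'a, 'p) multistream \<Rightarrow> nat \<Rightarrow> (nat \<times> nat \<Rightarrow> 'a) \<Rightarrow> real" where
  "dens_inf M n x = (\<Prod>t = 1..n. \<Prod>l = 1..streams M. pre M l t (stream_hist x l t) (x (t, l)))"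

definition dens_chg ::
  "('w, 'a, 'p) multistream \<Rightarrow> nat \<Rightarrow> nat \<Rightarrow> 'p \<Rightarrow> nat \<Rightarrow> (nat \<times> nat \<Rightarrow> 'a) \<Rightarrow> real" where
  "dens_chg M k i \<theta> n x =
     (if n \<le> k then dens_inf M n x
      else (\<Prod>t = 1..k. pre M i t (stream_hist x i t) (x (t, i)))
           * (\<Prod>t = k + 1..n. post M i \<theta> t (stream_hist x i t) (x (t, i)))
           * (\<Prod>j \<in> {1..streams M} - {i}. \<Prod>t = 1..n. pre M j t (stream_hist x j t) (x (t, j))))"

definition multistream_model :: "('w, 'a, 'p) multistream \<Rightarrow> bool" where
  "multistream_model M \<longleftrightarrow>
     2 \<le> streams M \<and>
     (\<forall>i \<in> {1..streams M}. sigma_finite_measure (base M i) \<and> param M i \<noteq> {} \<and>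
        (\<forall>t \<ge> 1. cond_density (base M i) t (pre M i t) \<and>
                (\<forall>\<theta> \<in> param M i. cond_density (base M i) t (post M i \<theta> t)))) \<and>
     prob_space (Pinf M) \<and>
     (\<forall>n. distributed (Pinf M) (sample_base M (enat n)) (sample M (enat n))
            (\<lambda>x. ennreal (dens_inf M n x))) \<and>
     (\<forall>i \<in> {1..streams M}. \<forall>\<theta> \<in> param M i.
        (\<forall>k. prob_space (Pchg M (int k) i \<theta>) \<and> sets (Pchg M (int k) i \<theta>) = sets (Pinf M) \<and>
             (\<forall>n. distributed (Pchg M (int k) i \<theta>) (sample_base M (enat n)) (sample M (enat n))
                    (\<lambda>x. ennreal (dens_chg M k i \<theta> n x)))) \<and>
        Pchg M (-1) i \<theta> = Pchg M 0 i \<theta>)"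

section \<open>Prior distribution of the change point\<close>

definition change_prior :: "(int \<Rightarrow> real) \<Rightarrow> bool" where
  "change_prior \<pi> \<longleftrightarrow>
     (\<forall>k \<ge> 0. 0 < \<pi> k) \<and> 0 \<le> \<pi> (-1) \<and> \<pi> (-1) < 1 \<and> (\<pi> has_sum 1) {-1..}"

definition prior_class :: "real \<Rightarrow> (int \<Rightarrow> real) set" where
  "prior_class \<mu> =
     {\<pi>. change_prior \<pi> \<and>
         (\<lambda>n. \<bar>ln (\<Sum>\<^sub>\<infinity>k \<in> {int n + 1..}. \<pi> k)\<bar> / real n) \<longlonglongrightarrow> \<mu> \<and>
         (\<mu> = 0 \<longrightarrow> (\<exists>r' \<ge> 1. (\<lambda>k. \<pi> k * \<bar>ln (\<pi> k)\<bar> powr r') summable_on {0..}))}"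

text \<open>
  \<open>prob_prior M \<pi> i \<theta> E\<close> is the probability, under the joint law of the change point \<open>\<nu>\<close> and the
  observations, of the event that \<open>E \<nu> \<omega>\<close> holds.
\<close>

definition prob_prior ::
  "('w, 'a, 'p) multistream \<Rightarrow> (int \<Rightarrow> real) \<Rightarrow> nat \<Rightarrow> 'p \<Rightarrow> (int \<Rightarrow> 'w \<Rightarrow> bool) \<Rightarrow> real" where
  "prob_prior M \<pi> i \<theta> E =
     (\<Sum>\<^sub>\<infinity>k \<in> {-1..}. \<pi> k * measure (Pchg M k i \<theta>) {\<omega> \<in> space (Pchg M k i \<theta>). E k \<omega>})"

section \<open>Detection-identification rules and error probabilities\<close>

definition obs_filtration :: "('w, 'a, 'p) multistream \<Rightarrow> enat \<Rightarrow> 'w measure" where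
  "obs_filtration M n = vimage_algebra (space (Pinf M)) (sample M n) (sample_base M n)"

text \<open>
  A rule is a pair \<open>(d, T)\<close>.  The stopping time may take the value \<open>\<infinity>\<close>; no decision is made then,
  and the value of \<open>d\<close> on \<open>T = \<infinity>\<close> is a dummy that enters none of the quantities below.
\<close>

type_synonym 'w rule = "('w \<Rightarrow> nat) \<times> ('w \<Rightarrow> enat)"

definition rules :: "('w, 'a, 'p) multistream \<Rightarrow> 'w rule set" where
  "rules M =
     {(d, T). stopping_time (obs_filtration M) T \<and>
        (\<forall>\<omega> \<in> space (Pinf M). d \<omega> \<in> {1..streams M}) \<and>
        (\<forall>j t. {\<omega> \<in> space (Pinf M). d \<omega> = j \<and> T \<omega> \<le> t} \<in> sets (obs_filtration M t))}"

definition stops_after :: "enat \<Rightarrow> int \<Rightarrow> bool" where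
  "stops_after \<tau> k \<longleftrightarrow> ereal (real_of_int k) < ereal_of_enat \<tau>"

definition PFA :: "('w, 'a, 'p) multistream \<Rightarrow> (int \<Rightarrow> real) \<Rightarrow> 'w rule \<Rightarrow> real" where
  "PFA M \<pi> = (\<lambda>(d, T).
     \<Sum>k. \<pi> (int k) * measure (Pinf M) {\<omega> \<in> space (Pinf M). T \<omega> \<le> enat k})"

definition PFA_stream :: "('w, 'a, 'p) multistream \<Rightarrow> (int \<Rightarrow> real) \<Rightarrow> nat \<Rightarrow> 'w rule \<Rightarrow> real" where
  "PFA_stream M \<pi> i = (\<lambda>(d, T).
     \<Sum>k. \<pi> (int k) * measure (Pinf M) {\<omega> \<in> space (Pinf M). T \<omega> \<le> enat k \<and> d \<omega> = i})"

definition PMI_pair ::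
  "('w, 'a, 'p) multistream \<Rightarrow> (int \<Rightarrow> real) \<Rightarrow> nat \<Rightarrow> nat \<Rightarrow> 'w rule \<Rightarrow> real" where
  "PMI_pair M \<pi> i j = (\<lambda>(d, T). SUP \<theta> \<in> param M i.
     prob_prior M \<pi> i \<theta> (\<lambda>k \<omega>. d \<omega> = j \<and> T \<omega> < \<infinity> \<and> stops_after (T \<omega>) k)
       / prob_prior M \<pi> i \<theta> (\<lambda>k \<omega>. stops_after (T \<omega>) k))"

definition PMI :: "('w, 'a, 'p) multistream \<Rightarrow> (int \<Rightarrow> real) \<Rightarrow> nat \<Rightarrow> 'w rule \<Rightarrow> real" where
  "PMI M \<pi> i = (\<lambda>(d, T). SUP \<theta> \<in> param M i.
     prob_prior M \<pi> i \<theta> (\<lambda>k \<omega>. d \<omega> \<noteq> i \<and> T \<omega> < \<infinity> \<and> stops_after (T \<omega>) k)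
       / prob_prior M \<pi> i \<theta> (\<lambda>k \<omega>. stops_after (T \<omega>) k))"

definition rule_class ::
  "('w, 'a, 'p) multistream \<Rightarrow> (int \<Rightarrow> real) \<Rightarrow> (nat \<Rightarrow> real) \<Rightarrow> (nat \<Rightarrow> nat \<Rightarrow> real) \<Rightarrow> 'w rule set"
  where
  "rule_class M \<pi> \<alpha> \<beta> =
     {\<delta> \<in> rules M. (\<forall>i \<in> {1..streams M}. PFA_stream M \<pi> i \<delta> \<le> \<alpha> i) \<and>
        (\<forall>i \<in> {1..streams M}. \<forall>j \<in> {1..streams M} - {i}. PMI_pair M \<pi> i j \<delta> \<le> \<beta> i j)}"

definition rule_class_star ::
  "('w, 'a, 'p) multistream \<Rightarrow> (int \<Rightarrow> real) \<Rightarrow> real \<Rightarrow> (nat \<Rightarrow> real) \<Rightarrow> 'w rule set" where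
  "rule_class_star M \<pi> \<alpha> \<beta> =
     {\<delta> \<in> rules M. PFA M \<pi> \<delta> \<le> \<alpha> \<and> (\<forall>i \<in> {1..streams M}. PMI M \<pi> i \<delta> \<le> \<beta> i)}"

section \<open>Risks\<close>

text \<open>
  The loss \<open>(T - k)\<^sup>r 1{d = i}\<close>, with \<open>T - k\<close> replaced by \<open>T\<close> for \<open>k = -1\<close>.  Where \<open>T = \<infinity>\<close> there
  is no decision to compare with \<open>i\<close>, and the infinite delay is charged to every stream.  Charging it
  only to the stream named by a dummy value of \<open>d\<close> would let the rule that never stops satisfy
  all error constraints with zero risk.
\<close>

definition delay_loss :: "real \<Rightarrow> int \<Rightarrow> nat \<Rightarrow> nat \<Rightarrow> enat \<Rightarrow> ennreal" where
  "delay_loss r k i d \<tau> = (case \<tau> of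
       enat n \<Rightarrow> if d = i then ennreal ((if k = -1 then real n else real n - real_of_int k) powr r)
                 else 0
     | \<infinity> \<Rightarrow> \<infinity>)"

definition delay_moment ::
  "('w, 'a, 'p) multistream \<Rightarrow> real \<Rightarrow> int \<Rightarrow> nat \<Rightarrow> 'p \<Rightarrow> 'w rule \<Rightarrow> ennreal" where
  "delay_moment M r k i \<theta> = (\<lambda>(d, T).
     \<integral>\<^sup>+ \<omega>. delay_loss r k i (d \<omega>) (T \<omega>) * indicator {\<omega>. stops_after (T \<omega>) k} \<omega>
       \<partial>Pchg M k i \<theta>)"

definition risk ::
  "('w, 'a, 'p) multistream \<Rightarrow> real \<Rightarrow> int \<Rightarrow> nat \<Rightarrow> 'p \<Rightarrow> 'w rule \<Rightarrow> ennreal" where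
  "risk M r k i \<theta> = (\<lambda>(d, T). delay_moment M r k i \<theta> (d, T)
     / ennreal (measure (Pchg M k i \<theta>) {\<omega> \<in> space (Pchg M k i \<theta>). stops_after (T \<omega>) k}))"

definition avg_risk ::
  "('w, 'a, 'p) multistream \<Rightarrow> (int \<Rightarrow> real) \<Rightarrow> real \<Rightarrow> nat \<Rightarrow> 'p \<Rightarrow> 'w rule \<Rightarrow> ennreal" where
  "avg_risk M \<pi> r i \<theta> \<delta> =
     (\<Sum>\<^sub>\<infinity>k \<in> {-1..}. ennreal (\<pi> k) * delay_moment M r k i \<theta> \<delta>) / ennreal (1 - PFA M \<pi> \<delta>)"

section \<open>Log-likelihood ratios\<close>

text \<open>
  Densities may vanish, so \<open>log (a / b)\<close> takes values in the extended reals; with the totalised real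
  functions \<open>ln (a / 0) = ln 0 = 0\<close>.  The case \<open>a = b = 0\<close> has probability zero wherever it is used.
\<close>

definition log_ratio :: "real \<Rightarrow> real \<Rightarrow> ereal" where
  "log_ratio a b =
     (if 0 < a \<and> 0 < b then ereal (ln (a / b)) else if 0 < a then \<infinity> else if 0 < b then -\<infinity> else 0)"

definition llr ::
  "('w, 'a, 'p) multistream \<Rightarrow> nat \<Rightarrow> 'p \<Rightarrow> nat \<Rightarrow> nat \<Rightarrow> 'w \<Rightarrow> ereal" where
  "llr M i \<theta> k n \<omega> =
     (\<Sum>t = k + 1..k + n.
        let h = (\<lambda>s \<in> {1..<t}. obs M s i \<omega>)
        in log_ratio (post M i \<theta> t h (obs M t i \<omega>)) (pre M i t h (obs M t i \<omega>)))"

text \<open>\<open>I0 i \<theta>\<close> is \<open>I_i(\<theta>)\<close> (the case \<open>j = 0\<close>), and \<open>I i j \<theta> \<theta>'\<close> is \<open>I_{ij}(\<theta>, \<theta>')\<close>.\<close>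

definition condition_C1 ::
  "('w, 'a, 'p) multistream \<Rightarrow> (nat \<Rightarrow> 'p \<Rightarrow> real) \<Rightarrow> (nat \<Rightarrow> nat \<Rightarrow> 'p \<Rightarrow> 'p \<Rightarrow> real) \<Rightarrow> bool" where
  "condition_C1 M I0 I \<longleftrightarrow>
     (\<forall>\<epsilon> > 0. \<forall>k :: nat. \<forall>i \<in> {1..streams M}. \<forall>\<theta> \<in> param M i.
        ((\<lambda>m. measure (Pchg M (int k) i \<theta>)
               {\<omega> \<in> space (Pchg M (int k) i \<theta>).
                 ereal ((1 + \<epsilon>) * I0 i \<theta>) \<le> (MAX n \<in> {1..m}. llr M i \<theta> k n \<omega>) / ereal (real m)})
           \<longlonglongrightarrow> 0) \<and>
        (\<forall>j \<in> {1..streams M} - {i}. \<forall>\<theta>' \<in> param M j.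
          (\<lambda>m. measure (Pchg M (int k) i \<theta>)
               {\<omega> \<in> space (Pchg M (int k) i \<theta>).
                 ereal ((1 + \<epsilon>) * I i j \<theta> \<theta>')
                   \<le> (MAX n \<in> {1..m}. llr M i \<theta> k n \<omega> - llr M j \<theta>' k n \<omega>) / ereal (real m)})
           \<longlonglongrightarrow> 0))"

section \<open>Asymptotic bounds\<close>

definition Psi ::
  "('w, 'a, 'p) multistream \<Rightarrow> (nat \<Rightarrow> 'p \<Rightarrow> real) \<Rightarrow> (nat \<Rightarrow> nat \<Rightarrow> 'p \<Rightarrow> 'p \<Rightarrow> real) \<Rightarrow> real \<Rightarrow>
    nat \<Rightarrow> 'p \<Rightarrow> (nat \<Rightarrow> real) \<Rightarrow> (nat \<Rightarrow> nat \<Rightarrow> real) \<Rightarrow> real" where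
  "Psi M I0 I \<mu> i \<theta> \<alpha> \<beta> =
     max (\<bar>ln (\<alpha> i)\<bar> / (I0 i \<theta> + \<mu>))
         (MAX j \<in> {1..streams M} - {i}. \<bar>ln (\<beta> j i)\<bar> / (INF \<theta>' \<in> param M j. I i j \<theta> \<theta>'))"

definition Psi_star ::
  "('w, 'a, 'p) multistream \<Rightarrow> (nat \<Rightarrow> 'p \<Rightarrow> real) \<Rightarrow> (nat \<Rightarrow> nat \<Rightarrow> 'p \<Rightarrow> 'p \<Rightarrow> real) \<Rightarrow> real \<Rightarrow>
    nat \<Rightarrow> 'p \<Rightarrow> real \<Rightarrow> (nat \<Rightarrow> real) \<Rightarrow> real" where
  "Psi_star M I0 I \<mu> i \<theta> \<alpha> \<beta> =
     max (\<bar>ln \<alpha>\<bar> / (I0 i \<theta> + \<mu>))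
         (MAX j \<in> {1..streams M} - {i}. \<bar>ln (\<beta> j)\<bar> / (INF \<theta>' \<in> param M j. I i j \<theta> \<theta>'))"

text \<open>
  The limits \<open>\<alpha>_max, \<beta>_max \<rightarrow> 0\<close> (and \<open>\<alpha>, \<beta>_max \<rightarrow> 0\<close>) over all error bounds with entries in
  \<open>(0, 1)\<close>, with no relation imposed between the rates of the entries.
\<close>

definition err_filter :: "nat \<Rightarrow> ((nat \<Rightarrow> real) \<times> (nat \<Rightarrow> nat \<Rightarrow> real)) filter" where
  "err_filter N =
     inf (filtercomap
            (\<lambda>(\<alpha>, \<beta>). (MAX i \<in> {1..N}. \<alpha> i, MAX (i, j) \<in> {1..N} \<times> {1..N} - Id. \<beta> i j))
            (nhds (0, 0)))
         (principal {(\<alpha>, \<beta>). (\<forall>i \<in> {1..N}. \<alpha> i \<in> {0<..<1}) \<and>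
                             (\<forall>i \<in> {1..N}. \<forall>j \<in> {1..N} - {i}. \<beta> i j \<in> {0<..<1})})"

definition err_filter_star :: "nat \<Rightarrow> (real \<times> (nat \<Rightarrow> real)) filter" where
  "err_filter_star N =
     inf (filtercomap (\<lambda>(\<alpha>, \<beta>). (\<alpha>, MAX i \<in> {1..N}. \<beta> i)) (nhds (0, 0)))
         (principal {(\<alpha>, \<beta>). \<alpha> \<in> {0<..<1} \<and> (\<forall>i \<in> {1..N}. \<beta> i \<in> {0<..<1})})"

end

theory Submission
  imports Defs
begin

text \<open>
  A rule that respects the error constraints cannot identify stream \<open>i\<close> correctly and quickly, because
  an event that is decided at time \<open>k + m\<close> has comparable probabilities under two laws whose
  likelihood ratio at that time is not too large.  Fix the change point \<open>k\<close> and the true pair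
  \<open>(i, \<theta>)\<close>, and let \<open>A\<close> be the event that stream \<open>i\<close> has been announced by time \<open>k + m\<close>.  Two
  competitors are available.

  Against the law without a change, condition C1 says that the log-likelihood ratio at time \<open>k + m\<close>
  is below \<open>(I0 i \<theta> + \<rho>) m\<close> with probability tending to one, so that \<open>A\<close> has probability at most
  \<open>exp ((I0 i \<theta> + \<rho>) m) Pinf(A) + o(1)\<close>.  The constraint on false alarms bounds \<open>Pinf(A)\<close> by
  \<open>\<alpha> i\<close> divided by the prior mass beyond \<open>k + m\<close>, and this mass is about \<open>exp (- \<mu> m)\<close>.  Hence \<open>A\<close> is
  improbable as long as \<open>m\<close> is at most a fraction \<open>s < 1\<close> of \<open>\<bar>ln (\<alpha> i)\<bar> / (I0 i \<theta> + \<mu>)\<close>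
  (\<open>eventually_early_alarm_small_by_PFA\<close>).

  Against a change at the same time \<open>k\<close> in another stream \<open>j\<close> with a parameter \<open>\<theta>'\<close> that nearly attains
  the infimum of \<open>I i j \<theta>\<close>, the same argument uses the constraint on misidentification: naming \<open>i\<close>
  after \<open>k\<close> has probability at most \<open>\<beta> j i / \<pi> k\<close> under the competitor.  This gives the second term
  of the bound (\<open>eventually_early_alarm_small_by_PMI\<close>).

  Since \<open>Psi\<close> is one of these terms, \<open>m = \<lfloor>s Psi\<rfloor>\<close> is within reach of one of the two arguments,
  whichever it is.  The remaining ways to avoid a delay of more than \<open>m\<close>, stopping by time \<open>k\<close> or
  naming a wrong stream after \<open>k\<close>, are errors whose probabilities are small with the bounds.  So the
  loss is at least \<open>(m + 1)\<^sup>r\<close> with probability close to one, uniformly over the class of rules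
  (\<open>delay_moment_ge\<close>, \<open>eventually_delay_moment_ge\<close>).  Markov's inequality in this form bounds the
  risk for each \<open>k \<ge> 0\<close>.  The law for \<open>k = -1\<close> is that for \<open>k = 0\<close> and its loss is no smaller.  The
  averaged risk is at least the sum over finitely many \<open>k\<close> that carry almost all of the prior mass
  (\<open>risk_bounds\<close>).

  For the starred problem, \<open>rule_class_star M \<pi> \<alpha> \<beta>\<close> is contained in \<open>rule_class\<close> with
  constant vector \<open>\<alpha>\<close> and with \<open>\<beta> i\<close> in place of all \<open>\<beta> i j\<close>, and \<open>Psi_star\<close> is \<open>Psi\<close> at these
  bounds, so that the lower bound carries over.
\<close>

section \<open>Observations and likelihood ratios\<close>

lemma model_obs_measurable:
  assumes M: "multistream_model M" and l: "l \<in> {1..streams M}" and t: "1 \<le> t"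
  shows "obs M t l \<in> Pinf M \<rightarrow>\<^sub>M base M l"
proof -
  have s: "sample M (enat t) \<in> Pinf M \<rightarrow>\<^sub>M sample_base M (enat t)"
    using M by (intro distributed_measurable) (auto simp: multistream_model_def)
  have idx: "(t, l) \<in> sample_idx M (enat t)"
    using l t by (simp add: sample_idx_def)
  have "(\<lambda>x. x (t, l)) \<in> sample_base M (enat t) \<rightarrow>\<^sub>M base M l"
    unfolding sample_base_def
    using measurable_component_singleton[OF idx, of "\<lambda>(t, l). base M l"] by simp
  from measurable_comp[OF s this] show ?thesis
    using idx by (simp add: comp_def sample_def)
qed

lemma model_hist_measurable:
  assumes M: "multistream_model M" and l: "l \<in> {1..streams M}"
  shows "(\<lambda>\<omega>. \<lambda>s\<in>{1..<t}. obs M s l \<omega>) \<in> Pinf M \<rightarrow>\<^sub>M PiM {1..<t} (\<lambda>_. base M l)"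
  by (rule measurable_restrict) (use model_obs_measurable[OF M l] in auto)

text \<open>
  The conditional densities of one observation given its own past, as functions of the sample point
  \<open>\<omega>\<close>.  In these terms the densities of the whole sample and the log-likelihood ratios are plain
  products and sums.
\<close>

definition pre_obs :: "('w, 'a, 'p) multistream \<Rightarrow> nat \<Rightarrow> nat \<Rightarrow> 'w \<Rightarrow> real" where
  "pre_obs M l t \<omega> = pre M l t (\<lambda>s\<in>{1..<t}. obs M s l \<omega>) (obs M t l \<omega>)"

definition post_obs :: "('w, 'a, 'p) multistream \<Rightarrow> nat \<Rightarrow> 'p \<Rightarrow> nat \<Rightarrow> 'w \<Rightarrow> real" where
  "post_obs M l \<theta> t \<omega> = post M l \<theta> t (\<lambda>s\<in>{1..<t}. obs M s l \<omega>) (obs M t l \<omega>)"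

lemma cond_density_obs:
  assumes M: "multistream_model M" and l: "l \<in> {1..streams M}" and t: "1 \<le> t"
    and q: "cond_density (base M l) t q"
  shows "(\<lambda>\<omega>. q (\<lambda>s\<in>{1..<t}. obs M s l \<omega>) (obs M t l \<omega>)) \<in> borel_measurable (Pinf M)"
    and "\<omega> \<in> space (Pinf M) \<Longrightarrow> 0 \<le> q (\<lambda>s\<in>{1..<t}. obs M s l \<omega>) (obs M t l \<omega>)"
proof -
  have "(\<lambda>\<omega>. (\<lambda>s\<in>{1..<t}. obs M s l \<omega>, obs M t l \<omega>))
      \<in> Pinf M \<rightarrow>\<^sub>M PiM {1..<t} (\<lambda>_. base M l) \<Otimes>\<^sub>M base M l"
    using model_hist_measurable[OF M l] model_obs_measurable[OF M l t] by (rule measurable_Pair)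
  moreover have "(\<lambda>(h, y). q h y) \<in> borel_measurable (PiM {1..<t} (\<lambda>_. base M l) \<Otimes>\<^sub>M base M l)"
    using q by (simp add: cond_density_def)
  ultimately have "(\<lambda>(h, y). q h y) \<circ> (\<lambda>\<omega>. (\<lambda>s\<in>{1..<t}. obs M s l \<omega>, obs M t l \<omega>)) \<in> borel_measurable (Pinf M)"
    by (rule measurable_comp)
  then show "(\<lambda>\<omega>. q (\<lambda>s\<in>{1..<t}. obs M s l \<omega>) (obs M t l \<omega>)) \<in> borel_measurable (Pinf M)"
    by (simp add: comp_def)
  show "0 \<le> q (\<lambda>s\<in>{1..<t}. obs M s l \<omega>) (obs M t l \<omega>)" if "\<omega> \<in> space (Pinf M)"
    using q measurable_space[OF model_hist_measurable[OF M l] that, of t]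
      measurable_space[OF model_obs_measurable[OF M l t] that]
    unfolding cond_density_def by blast
qed

lemma pre_obs_props:
  assumes M: "multistream_model M" and l: "l \<in> {1..streams M}" and t: "1 \<le> t"
  shows "pre_obs M l t \<in> borel_measurable (Pinf M)"
    and "\<omega> \<in> space (Pinf M) \<Longrightarrow> 0 \<le> pre_obs M l t \<omega>"
proof -
  have q: "cond_density (base M l) t (pre M l t)"
    using M l t unfolding multistream_model_def by blast
  show "pre_obs M l t \<in> borel_measurable (Pinf M)"
    unfolding pre_obs_def[abs_def] by (rule cond_density_obs(1)[OF M l t q])
  show "\<omega> \<in> space (Pinf M) \<Longrightarrow> 0 \<le> pre_obs M l t \<omega>"
    unfolding pre_obs_def by (rule cond_density_obs(2)[OF M l t q])
qed

lemma post_obs_props: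
  assumes M: "multistream_model M" and l: "l \<in> {1..streams M}" and \<theta>: "\<theta> \<in> param M l"
    and t: "1 \<le> t"
  shows "post_obs M l \<theta> t \<in> borel_measurable (Pinf M)"
    and "\<omega> \<in> space (Pinf M) \<Longrightarrow> 0 \<le> post_obs M l \<theta> t \<omega>"
proof -
  have q: "cond_density (base M l) t (post M l \<theta> t)"
    using M l t \<theta> unfolding multistream_model_def by blast
  show "post_obs M l \<theta> t \<in> borel_measurable (Pinf M)"
    unfolding post_obs_def[abs_def] by (rule cond_density_obs(1)[OF M l t q])
  show "\<omega> \<in> space (Pinf M) \<Longrightarrow> 0 \<le> post_obs M l \<theta> t \<omega>"
    unfolding post_obs_def by (rule cond_density_obs(2)[OF M l t q])
qed

lemma llr_eq: "llr M i \<theta> k n \<omega> = (\<Sum>t = k + 1..k + n. log_ratio (post_obs M i \<theta> t \<omega>) (pre_obs M i t \<omega>))"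
  by (simp add: llr_def pre_obs_def post_obs_def Let_def)

lemma log_ratio_measurable [measurable]:
  assumes [measurable]: "f \<in> borel_measurable N" "g \<in> borel_measurable N"
  shows "(\<lambda>\<omega>. log_ratio (f \<omega>) (g \<omega>)) \<in> borel_measurable N"
  unfolding log_ratio_def by measurable

lemma llr_measurable:
  assumes M: "multistream_model M" and i: "i \<in> {1..streams M}" and \<theta>: "\<theta> \<in> param M i"
  shows "llr M i \<theta> k n \<in> borel_measurable (Pinf M)"
  unfolding llr_eq[abs_def]
  by (intro borel_measurable_ereal_sum log_ratio_measurable pre_obs_props[OF M i] post_obs_props[OF M i \<theta>]) auto

lemma stream_hist_sample:
  assumes "l \<in> {1..streams M}" "1 \<le> t" "t \<le> n"
  shows "stream_hist (sample M (enat n) \<omega>) l t = (\<lambda>s\<in>{1..<t}. obs M s l \<omega>)"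
    and "sample M (enat n) \<omega> (t, l) = obs M t l \<omega>"
  using assms by (auto simp: stream_hist_def sample_def sample_idx_def fun_eq_iff restrict_def)

lemma dens_inf_sample:
  "dens_inf M n (sample M (enat n) \<omega>) = (\<Prod>l = 1..streams M. \<Prod>t = 1..n. pre_obs M l t \<omega>)"
  unfolding dens_inf_def
  by (subst prod.swap) (intro prod.cong refl, auto simp: stream_hist_sample pre_obs_def)

lemma dens_chg_sample:
  assumes "i \<in> {1..streams M}" "k < n"
  shows "dens_chg M k i \<theta> n (sample M (enat n) \<omega>) =
     (\<Prod>t = 1..k. pre_obs M i t \<omega>) * (\<Prod>t = k + 1..n. post_obs M i \<theta> t \<omega>)
       * (\<Prod>j \<in> {1..streams M} - {i}. \<Prod>t = 1..n. pre_obs M j t \<omega>)"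
proof -
  have "(\<Prod>t = 1..k. pre M i t (stream_hist (sample M (enat n) \<omega>) i t) (sample M (enat n) \<omega> (t, i)))
      = (\<Prod>t = 1..k. pre_obs M i t \<omega>)"
    "(\<Prod>t = k + 1..n. post M i \<theta> t (stream_hist (sample M (enat n) \<omega>) i t) (sample M (enat n) \<omega> (t, i)))
      = (\<Prod>t = k + 1..n. post_obs M i \<theta> t \<omega>)"
    "(\<Prod>j \<in> {1..streams M} - {i}. \<Prod>t = 1..n. pre M j t (stream_hist (sample M (enat n) \<omega>) j t)
        (sample M (enat n) \<omega> (t, j))) = (\<Prod>j \<in> {1..streams M} - {i}. \<Prod>t = 1..n. pre_obs M j t \<omega>)"
    using assms by (auto intro!: prod.cong simp: stream_hist_sample pre_obs_def post_obs_def)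
  then show ?thesis
    using assms by (simp add: dens_chg_def)
qed

text \<open>
  Terms with \<open>0 < a t\<close> never equal \<open>-\<infinity>\<close>, so the sum of extended reals is either a genuine logarithm
  of a quotient or \<open>\<infinity>\<close>.
\<close>

lemma sum_log_ratio_pos:
  assumes "finite A" "\<And>t. t \<in> A \<Longrightarrow> 0 < a t" "\<And>t. t \<in> A \<Longrightarrow> 0 \<le> b t"
  shows "(\<Sum>t\<in>A. log_ratio (a t) (b t))
    = (if \<forall>t\<in>A. 0 < b t then ereal (ln (prod a A / prod b A)) else \<infinity>)"
proof (cases "\<forall>t\<in>A. 0 < b t")
  case True
  have "(\<Sum>t\<in>A. log_ratio (a t) (b t)) = (\<Sum>t\<in>A. ereal (ln (a t / b t)))"
    using True assms by (intro sum.cong) (auto simp: log_ratio_def)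
  also have "\<dots> = ereal (ln (\<Prod>t\<in>A. a t / b t))"
    using True assms(1,2) by (subst ln_prod) (auto simp: less_imp_neq[THEN not_sym])
  finally show ?thesis using True by (simp add: prod_dividef)
next
  case False
  have nz: "log_ratio (a t) (b t) \<noteq> -\<infinity>" if "t \<in> A" for t
    using assms that by (auto simp: log_ratio_def)
  from False obtain t where t: "t \<in> A" "\<not> 0 < b t" by blast
  then have "log_ratio (a t) (b t) = \<infinity>"
    using assms(2)[OF t(1)] by (simp add: log_ratio_def)
  then have "(\<Sum>t\<in>A. log_ratio (a t) (b t)) = \<infinity>"
    using t nz assms(1) by (simp add: sum_Pinfty) blast
  then show ?thesis by (simp only: False if_False)
qed

lemma sum_log_ratio_swap:
  assumes "finite A" "\<And>t. t \<in> A \<Longrightarrow> 0 \<le> a t" "\<And>t. t \<in> A \<Longrightarrow> 0 < b t"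
  shows "(\<Sum>t\<in>A. log_ratio (a t) (b t)) = - (\<Sum>t\<in>A. log_ratio (b t) (a t))"
  using assms
proof (induction A rule: finite_induct)
  case (insert x F)
  have 1: "log_ratio (a x) (b x) = - log_ratio (b x) (a x)" "log_ratio (b x) (a x) \<noteq> -\<infinity>"
    using insert.prems by (auto simp: log_ratio_def ln_div)
  have 2: "(\<Sum>t\<in>F. log_ratio (b t) (a t)) \<noteq> -\<infinity>"
    using insert.prems insert.hyps by (subst sum_log_ratio_pos) auto
  have 3: "(\<Sum>t\<in>F. log_ratio (a t) (b t)) = - (\<Sum>t\<in>F. log_ratio (b t) (a t))"
    using insert by simp
  show ?case
    using insert.hyps 1 2 3
    by (cases "log_ratio (b x) (a x)"; cases "\<Sum>t\<in>F. log_ratio (b t) (a t)") auto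
qed simp

text \<open>
  The strict inequality between the products forces \<open>0 < a t\<close> for every \<open>t\<close>.  This is what makes it
  harmless that densities may vanish: wherever the likelihood ratio exceeds \<open>c\<close>, the sum involves
  no indeterminate terms.
\<close>

lemma le_sum_log_ratio:
  assumes "finite A" "\<And>t. t \<in> A \<Longrightarrow> 0 \<le> a t" "\<And>t. t \<in> A \<Longrightarrow> 0 \<le> b t"
    and c: "0 < c" "c * prod b A < prod a A"
  shows "ereal (ln c) \<le> (\<Sum>t\<in>A. log_ratio (a t) (b t))"
proof -
  have "0 \<le> c * prod b A" using c(1) assms(3) by (simp add: prod_nonneg)
  then have "0 < prod a A" using c(2) by simp
  have "a t \<noteq> 0" if "t \<in> A" for t
  proof
    assume "a t = 0"
    then have "prod a A = 0" using assms(1) that by (intro prod_zero) auto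
    then show False using \<open>0 < prod a A\<close> by simp
  qed
  then have a: "0 < a t" if "t \<in> A" for t
    using assms(2)[OF that] that by fastforce
  show ?thesis
  proof (cases "\<forall>t\<in>A. 0 < b t")
    case True
    then have "0 < prod b A" by (simp add: prod_pos)
    then have "c \<le> prod a A / prod b A" using c by (simp add: field_simps)
    then have "ln c \<le> ln (prod a A / prod b A)" using c(1) by (simp add: ln_mono)
    then show ?thesis using True a assms by (simp add: sum_log_ratio_pos)
  next
    case False
    then show ?thesis using a assms(1,3) by (subst sum_log_ratio_pos) auto
  qed
qed

text \<open>
  The same for a difference: now \<open>a\<close> and \<open>b'\<close> are positive, and subtracting the second sum amounts to
  adding the sum of the swapped ratios, so that \<open>\<infinity> - \<infinity>\<close> does not occur.
\<close>

lemma le_diff_sum_log_ratio: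
  assumes "finite A" "\<And>t. t \<in> A \<Longrightarrow> 0 \<le> a t" "\<And>t. t \<in> A \<Longrightarrow> 0 \<le> b t"
    "\<And>t. t \<in> A \<Longrightarrow> 0 \<le> a' t" "\<And>t. t \<in> A \<Longrightarrow> 0 \<le> b' t"
    and c: "0 < c" "c * (prod b A * prod a' A) < prod a A * prod b' A"
  shows "ereal (ln c) \<le> (\<Sum>t\<in>A. log_ratio (a t) (b t)) - (\<Sum>t\<in>A. log_ratio (a' t) (b' t))"
proof -
  have "0 \<le> c * (prod b A * prod a' A)" using c(1) assms(3,4) by (simp add: prod_nonneg)
  then have "0 < prod a A * prod b' A" using c(2) by simp
  have "a t \<noteq> 0 \<and> b' t \<noteq> 0" if "t \<in> A" for t
  proof (rule ccontr)
    assume "\<not> (a t \<noteq> 0 \<and> b' t \<noteq> 0)"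
    then have "prod a A = 0 \<or> prod b' A = 0" using assms(1) that by (metis prod_zero)
    then show False using \<open>0 < prod a A * prod b' A\<close> by auto
  qed
  then have a: "0 < a t" "0 < b' t" if "t \<in> A" for t
    using assms(2,5)[OF that] that by fastforce+
  have eq: "(\<Sum>t\<in>A. log_ratio (a t) (b t)) - (\<Sum>t\<in>A. log_ratio (a' t) (b' t))
    = (\<Sum>t\<in>A. log_ratio (a t) (b t)) + (\<Sum>t\<in>A. log_ratio (b' t) (a' t))"
    using a assms by (subst sum_log_ratio_swap) (auto simp: minus_ereal_def)
  show ?thesis
  proof (cases "(\<forall>t\<in>A. 0 < b t) \<and> (\<forall>t\<in>A. 0 < a' t)")
    case True
    then have p: "0 < prod b A" "0 < prod a' A" "0 < prod a A" "0 < prod b' A"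
      using a by (auto simp: prod_pos)
    then have "c \<le> (prod a A / prod b A) * (prod b' A / prod a' A)" using c by (simp add: field_simps)
    then have "ln c \<le> ln ((prod a A / prod b A) * (prod b' A / prod a' A))"
      using c(1) by (simp add: ln_mono)
    also have "\<dots> = ln (prod a A / prod b A) + ln (prod b' A / prod a' A)"
      using p by (intro ln_mult_pos) auto
    finally show ?thesis using True a assms unfolding eq by (simp add: sum_log_ratio_pos)
  next
    case False
    then have "(\<Sum>t\<in>A. log_ratio (a t) (b t)) + (\<Sum>t\<in>A. log_ratio (b' t) (a' t)) = \<infinity>"
      using a assms by (subst (1 2) sum_log_ratio_pos) auto
    then show ?thesis unfolding eq by (metis ereal_less_eq(1))
  qed
qed

lemma prod_split_at:
  fixes f :: "nat \<Rightarrow> real"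
  assumes "k \<le> n"
  shows "prod f {1..n} = prod f {1..k} * prod f {k + 1..n}"
proof -
  have "{1..n} = {1..k} \<union> {k + 1..n}" "{1..k} \<inter> {k + 1..n} = {}" using assms by auto
  then show ?thesis by (metis finite_atLeastAtMost prod.union_disjoint)
qed

text \<open>
  The two densities share all factors except those of stream \<open>i\<close> at the times \<open>k + 1, \<dots>, k + m\<close>.
  The common factor \<open>R\<close> is positive wherever the strict inequality holds, and cancels.
\<close>

lemma llr_ge_of_dens_inf:
  assumes M: "multistream_model M" and i: "i \<in> {1..streams M}" and \<theta>: "\<theta> \<in> param M i"
    and m: "1 \<le> m" and \<omega>: "\<omega> \<in> space (Pinf M)" and c: "0 < c"
    and less: "c * dens_inf M (k + m) (sample M (enat (k + m)) \<omega>)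
      < dens_chg M k i \<theta> (k + m) (sample M (enat (k + m)) \<omega>)"
  shows "ereal (ln c) \<le> llr M i \<theta> k m \<omega>"
proof -
  let ?g = "\<lambda>l t. pre_obs M l t \<omega>" and ?f = "\<lambda>t. post_obs M i \<theta> t \<omega>"
  let ?A = "{k + 1..k + m}"
  define R where "R = prod (?g i) {1..k} * (\<Prod>j \<in> {1..streams M} - {i}. \<Prod>t = 1..k + m. ?g j t)"
  have R: "0 \<le> R"
    unfolding R_def using i pre_obs_props(2)[OF M _ _ \<omega>] by (auto intro!: mult_nonneg_nonneg prod_nonneg)
  have "prod (?g i) {1..k + m} = prod (?g i) {1..k} * prod (?g i) ?A"
    by (rule prod_split_at) simp
  then have "dens_inf M (k + m) (sample M (enat (k + m)) \<omega>) = R * prod (?g i) ?A"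
    unfolding dens_inf_sample R_def
    by (subst prod.remove[OF _ i]) (simp_all only: finite_atLeastAtMost mult_ac)
  moreover have "dens_chg M k i \<theta> (k + m) (sample M (enat (k + m)) \<omega>) = R * prod ?f ?A"
    using i m by (simp add: dens_chg_sample R_def)
  ultimately have "R * (c * prod (?g i) ?A) < R * prod ?f ?A"
    using less by (simp add: mult.left_commute)
  then have "c * prod (?g i) ?A < prod ?f ?A"
    using R by (simp add: mult_less_cancel_left)
  then show ?thesis
    unfolding llr_eq using c pre_obs_props(2)[OF M i _ \<omega>] post_obs_props(2)[OF M i \<theta> _ \<omega>]
    by (intro le_sum_log_ratio) auto
qed

text \<open>
  Here the densities differ in the streams \<open>i\<close> and \<open>j\<close> after time \<open>k\<close>: each law has post-change
  factors in its own stream and pre-change factors in the other one.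
\<close>

lemma llr_diff_ge_of_dens_chg:
  assumes M: "multistream_model M" and i: "i \<in> {1..streams M}" and \<theta>: "\<theta> \<in> param M i"
    and j: "j \<in> {1..streams M} - {i}" and \<theta>': "\<theta>' \<in> param M j"
    and m: "1 \<le> m" and \<omega>: "\<omega> \<in> space (Pinf M)" and c: "0 < c"
    and less: "c * dens_chg M k j \<theta>' (k + m) (sample M (enat (k + m)) \<omega>)
      < dens_chg M k i \<theta> (k + m) (sample M (enat (k + m)) \<omega>)"
  shows "ereal (ln c) \<le> llr M i \<theta> k m \<omega> - llr M j \<theta>' k m \<omega>"
proof -
  let ?g = "\<lambda>l t. pre_obs M l t \<omega>" and ?f = "\<lambda>t. post_obs M i \<theta> t \<omega>"
    and ?f' = "\<lambda>t. post_obs M j \<theta>' t \<omega>"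
  let ?A = "{k + 1..k + m}"
  have j': "j \<in> {1..streams M}" "j \<noteq> i" using j by auto
  define R where "R = prod (?g i) {1..k} * prod (?g j) {1..k}
    * (\<Prod>l \<in> {1..streams M} - {i} - {j}. \<Prod>t = 1..k + m. ?g l t)"
  have R: "0 \<le> R"
    unfolding R_def using i j' pre_obs_props(2)[OF M _ _ \<omega>]
    by (auto intro!: mult_nonneg_nonneg prod_nonneg)
  have "(\<Prod>l \<in> {1..streams M} - {i}. \<Prod>t = 1..k + m. ?g l t)
      = prod (?g j) {1..k + m} * (\<Prod>l \<in> {1..streams M} - {i} - {j}. \<Prod>t = 1..k + m. ?g l t)"
    using j by (intro prod.remove) auto
  then have 1: "dens_chg M k i \<theta> (k + m) (sample M (enat (k + m)) \<omega>) = R * (prod ?f ?A * prod (?g j) ?A)"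
    using i m prod_split_at[of k "k + m" "?g j"] by (simp only: dens_chg_sample R_def) (simp add: mult_ac)
  have "(\<Prod>l \<in> {1..streams M} - {j}. \<Prod>t = 1..k + m. ?g l t)
      = prod (?g i) {1..k + m} * (\<Prod>l \<in> {1..streams M} - {j} - {i}. \<Prod>t = 1..k + m. ?g l t)"
    using i j' by (intro prod.remove) auto
  moreover have "{1..streams M} - {j} - {i} = {1..streams M} - {i} - {j}" by blast
  ultimately have 2: "dens_chg M k j \<theta>' (k + m) (sample M (enat (k + m)) \<omega>)
      = R * (prod (?g i) ?A * prod ?f' ?A)"
    using j' m prod_split_at[of k "k + m" "?g i"] by (simp add: dens_chg_sample R_def)
  have "R * (c * (prod (?g i) ?A * prod ?f' ?A)) < R * (prod ?f ?A * prod (?g j) ?A)"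
    using less unfolding 1 2 by (simp add: mult.left_commute)
  then have "c * (prod (?g i) ?A * prod ?f' ?A) < prod ?f ?A * prod (?g j) ?A"
    using R by (simp add: mult_less_cancel_left)
  then show ?thesis
    unfolding llr_eq using c pre_obs_props(2)[OF M i _ \<omega>] post_obs_props(2)[OF M i \<theta> _ \<omega>]
      pre_obs_props(2)[OF M j'(1) _ \<omega>] post_obs_props(2)[OF M j'(1) \<theta>' _ \<omega>]
    by (intro le_diff_sum_log_ratio) auto
qed

section \<open>Changes of measure\<close>

lemma model_Pchg:
  assumes M: "multistream_model M" and i: "i \<in> {1..streams M}" and \<theta>: "\<theta> \<in> param M i"
  shows "prob_space (Pchg M (int k) i \<theta>)" "sets (Pchg M (int k) i \<theta>) = sets (Pinf M)"
    "space (Pchg M (int k) i \<theta>) = space (Pinf M)"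
    "distributed (Pchg M (int k) i \<theta>) (sample_base M (enat n)) (sample M (enat n))
       (\<lambda>x. ennreal (dens_chg M k i \<theta> n x))"
    "Pchg M (-1) i \<theta> = Pchg M 0 i \<theta>"
proof -
  show "prob_space (Pchg M (int k) i \<theta>)" and s: "sets (Pchg M (int k) i \<theta>) = sets (Pinf M)"
    and "distributed (Pchg M (int k) i \<theta>) (sample_base M (enat n)) (sample M (enat n))
       (\<lambda>x. ennreal (dens_chg M k i \<theta> n x))" and "Pchg M (-1) i \<theta> = Pchg M 0 i \<theta>"
    using assms unfolding multistream_model_def by blast+
  show "space (Pchg M (int k) i \<theta>) = space (Pinf M)"
    by (rule sets_eq_imp_space_eq[OF s])
qed

lemma model_Pchg_from_minus_one:
  assumes M: "multistream_model M" and i: "i \<in> {1..streams M}" and \<theta>: "\<theta> \<in> param M i"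
    and k: "-1 \<le> k"
  shows "prob_space (Pchg M k i \<theta>)" "sets (Pchg M k i \<theta>) = sets (Pinf M)"
    "space (Pchg M k i \<theta>) = space (Pinf M)"
proof -
  have "Pchg M k i \<theta> = Pchg M (int (nat k)) i \<theta>"
    using k model_Pchg(5)[OF M i \<theta>] by (cases "k = -1") auto
  then show "prob_space (Pchg M k i \<theta>)" "sets (Pchg M k i \<theta>) = sets (Pinf M)"
    "space (Pchg M k i \<theta>) = space (Pinf M)"
    using model_Pchg[OF M i \<theta>] by metis+
qed

lemma model_Pinf:
  assumes M: "multistream_model M"
  shows "prob_space (Pinf M)"
    "distributed (Pinf M) (sample_base M (enat n)) (sample M (enat n)) (\<lambda>x. ennreal (dens_inf M n x))"
  using assms unfolding multistream_model_def by blast+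

lemma sets_obs_filtration:
  assumes M: "multistream_model M"
  shows "sets (obs_filtration M (enat n))
    = {sample M (enat n) -` B \<inter> space (Pinf M) | B. B \<in> sets (sample_base M (enat n))}"
    and "sets (obs_filtration M (enat n)) \<subseteq> sets (Pinf M)"
proof -
  have s: "sample M (enat n) \<in> Pinf M \<rightarrow>\<^sub>M sample_base M (enat n)"
    by (rule distributed_measurable[OF model_Pinf(2)[OF M]])
  then show eq: "sets (obs_filtration M (enat n))
    = {sample M (enat n) -` B \<inter> space (Pinf M) | B. B \<in> sets (sample_base M (enat n))}"
    unfolding obs_filtration_def by (intro sets_vimage_algebra2) (auto dest: measurable_space)
  show "sets (obs_filtration M (enat n)) \<subseteq> sets (Pinf M)"
    unfolding eq using measurable_sets[OF s] by blast
qed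

text \<open>
  Split according to whether \<open>f \<le> c g\<close>: on that part the densities compare pointwise, and the
  rest lies in \<open>D\<close>.  The set \<open>D\<close> is only required to contain the region of a large likelihood
  ratio, because the event of condition C1, to which this is applied, is larger than that region.
\<close>

lemma change_of_measure:
  assumes P: "distributed P S X (\<lambda>x. ennreal (f x))" and Q: "distributed Q S X (\<lambda>x. ennreal (g x))"
    and "prob_space P" "prob_space Q" and sp: "space Q = space P" and c: "0 \<le> c"
    and B: "B \<in> sets S" and D: "D \<in> sets P"
    and sub: "\<And>\<omega>. \<omega> \<in> space P \<Longrightarrow> c * g (X \<omega>) < f (X \<omega>) \<Longrightarrow> \<omega> \<in> D"
  shows "measure P (X -` B \<inter> space P) \<le> c * measure Q (X -` B \<inter> space P) + measure P D"
proof -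
  interpret P: prob_space P by fact
  interpret Q: prob_space Q by fact
  have X: "X \<in> P \<rightarrow>\<^sub>M S" by (rule distributed_measurable[OF P])
  have [measurable]: "(\<lambda>x. ennreal (f x)) \<in> borel_measurable S" "(\<lambda>x. ennreal (g x)) \<in> borel_measurable S"
    using distributed_borel_measurable[OF P] distributed_borel_measurable[OF Q] .
  define E where "E = {x \<in> space S. ennreal (f x) \<le> ennreal c * ennreal (g x)}"
  have E: "E \<in> sets S" unfolding E_def by measurable
  have "emeasure P (X -` (B \<inter> E) \<inter> space P) = (\<integral>\<^sup>+x. ennreal (f x) * indicator (B \<inter> E) x \<partial>S)"
    using B E by (intro distributed_emeasure[OF P]) auto
  also have "\<dots> \<le> (\<integral>\<^sup>+x. ennreal c * (ennreal (g x) * indicator B x) \<partial>S)"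
    by (intro nn_integral_mono) (auto simp: E_def indicator_def)
  also have "\<dots> = ennreal c * (\<integral>\<^sup>+x. ennreal (g x) * indicator B x \<partial>S)"
    using B by (intro nn_integral_cmult borel_measurable_times_ennreal borel_measurable_indicator) auto
  also have "(\<integral>\<^sup>+x. ennreal (g x) * indicator B x \<partial>S) = emeasure Q (X -` B \<inter> space P)"
    using distributed_emeasure[OF Q B] sp by simp
  finally have "ennreal (measure P (X -` (B \<inter> E) \<inter> space P)) \<le> ennreal (c * measure Q (X -` B \<inter> space P))"
    using c by (simp add: P.emeasure_eq_measure Q.emeasure_eq_measure ennreal_mult'')
  then have le: "measure P (X -` (B \<inter> E) \<inter> space P) \<le> c * measure Q (X -` B \<inter> space P)"
    using c by (subst (asm) ennreal_le_iff) auto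
  have "X -` B \<inter> space P \<subseteq> (X -` (B \<inter> E) \<inter> space P) \<union> D"
  proof
    fix \<omega> assume \<omega>: "\<omega> \<in> X -` B \<inter> space P"
    show "\<omega> \<in> (X -` (B \<inter> E) \<inter> space P) \<union> D"
    proof (cases "ennreal (f (X \<omega>)) \<le> ennreal c * ennreal (g (X \<omega>))")
      case True
      then show ?thesis using \<omega> measurable_space[OF X] by (auto simp: E_def)
    next
      case False
      have "c * g (X \<omega>) < f (X \<omega>)"
      proof (rule ccontr)
        assume "\<not> c * g (X \<omega>) < f (X \<omega>)"
        then have "ennreal (f (X \<omega>)) \<le> ennreal (c * g (X \<omega>))" by (intro ennreal_leI) auto
        also have "\<dots> = ennreal c * ennreal (g (X \<omega>))" using c by (simp add: ennreal_mult')
        finally show False using False by blast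
      qed
      then show ?thesis using \<omega> sub by auto
    qed
  qed
  moreover have BE: "X -` (B \<inter> E) \<inter> space P \<in> sets P"
    using B E by (intro measurable_sets[OF X]) auto
  ultimately have "measure P (X -` B \<inter> space P) \<le> measure P ((X -` (B \<inter> E) \<inter> space P) \<union> D)"
    using D by (intro P.finite_measure_mono sets.Un)
  also have "\<dots> \<le> measure P (X -` (B \<inter> E) \<inter> space P) + measure P D"
    using BE D by (rule measure_Un_le)
  finally show ?thesis using le by simp
qed

lemma le_Max_divide:
  fixes f :: "nat \<Rightarrow> ereal"
  assumes "1 \<le> m" "ereal (a * real m) \<le> f m"
  shows "ereal a \<le> (MAX n \<in> {1..m}. f n) / ereal (real m)"
proof -
  have "ereal (real m) * ereal a \<le> f m" using assms(2) by (simp add: mult.commute)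
  also have "\<dots> \<le> (MAX n \<in> {1..m}. f n)" using assms(1) by (intro Max_ge) auto
  finally show ?thesis using assms(1) by (subst ereal_le_divide_pos) auto
qed

text \<open>
  Only the ratio at the final time \<open>k + m\<close> matters, since the event \<open>A\<close> is decided by then.  The
  maximum over \<open>n\<close> appears because condition C1 is stated for it.
\<close>

lemma Pchg_le_Pinf:
  assumes M: "multistream_model M" and i: "i \<in> {1..streams M}" and \<theta>: "\<theta> \<in> param M i"
    and m: "1 \<le> m" and A: "A \<in> sets (obs_filtration M (enat (k + m)))"
  shows "measure (Pchg M (int k) i \<theta>) A \<le> exp (a * real m) * measure (Pinf M) A
    + measure (Pchg M (int k) i \<theta>) {\<omega> \<in> space (Pchg M (int k) i \<theta>).
        ereal a \<le> (MAX n \<in> {1..m}. llr M i \<theta> k n \<omega>) / ereal (real m)}"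
proof -
  note P = model_Pchg(1-4)[OF M i \<theta>, of k]
  let ?D = "{\<omega> \<in> space (Pchg M (int k) i \<theta>).
        ereal a \<le> (MAX n \<in> {1..m}. llr M i \<theta> k n \<omega>) / ereal (real m)}"
  obtain B where B: "B \<in> sets (sample_base M (enat (k + m)))"
    "A = sample M (enat (k + m)) -` B \<inter> space (Pinf M)"
    using A unfolding sets_obs_filtration(1)[OF M] by blast
  have [measurable]: "llr M i \<theta> k n \<in> borel_measurable (Pinf M)" for n
    by (rule llr_measurable[OF M i \<theta>])
  have "{\<omega> \<in> space (Pinf M). ereal a \<le> (MAX n \<in> {1..m}. llr M i \<theta> k n \<omega>) / ereal (real m)} \<in> sets (Pinf M)"
    by measurable
  then have D: "?D \<in> sets (Pchg M (int k) i \<theta>)" by (simp only: P(2,3))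
  have "measure (Pchg M (int k) i \<theta>) (sample M (enat (k + m)) -` B \<inter> space (Pchg M (int k) i \<theta>))
    \<le> exp (a * real m) * measure (Pinf M) (sample M (enat (k + m)) -` B \<inter> space (Pchg M (int k) i \<theta>))
      + measure (Pchg M (int k) i \<theta>) ?D"
  proof (rule change_of_measure[OF P(4) model_Pinf(2)[OF M] P(1) model_Pinf(1)[OF M] _ _ B(1) D])
    fix \<omega> assume "\<omega> \<in> space (Pchg M (int k) i \<theta>)"
      and less: "exp (a * real m) * dens_inf M (k + m) (sample M (enat (k + m)) \<omega>)
        < dens_chg M k i \<theta> (k + m) (sample M (enat (k + m)) \<omega>)"
    then have \<omega>: "\<omega> \<in> space (Pinf M)" by (simp only: P(3))
    have "ereal (a * real m) \<le> llr M i \<theta> k m \<omega>"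
      using llr_ge_of_dens_inf[OF M i \<theta> m \<omega> exp_gt_zero less] by (simp only: ln_exp)
    from le_Max_divide[of m a "\<lambda>n. llr M i \<theta> k n \<omega>", OF m this] \<omega>
    show "\<omega> \<in> ?D" by (simp only: P(3) mem_Collect_eq simp_thms)
  qed (simp_all only: P(3) exp_ge_zero)
  then show ?thesis by (simp only: B(2) P(3))
qed

lemma Pchg_le_Pchg:
  assumes M: "multistream_model M" and i: "i \<in> {1..streams M}" and \<theta>: "\<theta> \<in> param M i"
    and j: "j \<in> {1..streams M} - {i}" and \<theta>': "\<theta>' \<in> param M j"
    and m: "1 \<le> m" and A: "A \<in> sets (obs_filtration M (enat (k + m)))"
  shows "measure (Pchg M (int k) i \<theta>) A \<le> exp (a * real m) * measure (Pchg M (int k) j \<theta>') A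
    + measure (Pchg M (int k) i \<theta>) {\<omega> \<in> space (Pchg M (int k) i \<theta>).
        ereal a \<le> (MAX n \<in> {1..m}. llr M i \<theta> k n \<omega> - llr M j \<theta>' k n \<omega>) / ereal (real m)}"
proof -
  have j': "j \<in> {1..streams M}" using j by simp
  note P = model_Pchg(1-4)[OF M i \<theta>, of k] and P' = model_Pchg(1-4)[OF M j' \<theta>', of k]
  let ?D = "{\<omega> \<in> space (Pchg M (int k) i \<theta>).
        ereal a \<le> (MAX n \<in> {1..m}. llr M i \<theta> k n \<omega> - llr M j \<theta>' k n \<omega>) / ereal (real m)}"
  obtain B where B: "B \<in> sets (sample_base M (enat (k + m)))"
    "A = sample M (enat (k + m)) -` B \<inter> space (Pinf M)"
    using A unfolding sets_obs_filtration(1)[OF M] by blast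
  have [measurable]: "(\<lambda>\<omega>. (MAX n \<in> {1..m}. llr M i \<theta> k n \<omega> - llr M j \<theta>' k n \<omega>) / ereal (real m))
      \<in> borel_measurable (Pinf M)"
    by (intro borel_measurable_ereal_divide borel_measurable_Max borel_measurable_ereal_diff
        borel_measurable_const llr_measurable[OF M i \<theta>] llr_measurable[OF M j' \<theta>'] finite_atLeastAtMost)
  have "{\<omega> \<in> space (Pinf M). ereal a
      \<le> (MAX n \<in> {1..m}. llr M i \<theta> k n \<omega> - llr M j \<theta>' k n \<omega>) / ereal (real m)} \<in> sets (Pinf M)"
    by measurable
  then have D: "?D \<in> sets (Pchg M (int k) i \<theta>)" by (simp only: P(2,3))
  have "measure (Pchg M (int k) i \<theta>) (sample M (enat (k + m)) -` B \<inter> space (Pchg M (int k) i \<theta>))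
    \<le> exp (a * real m)
        * measure (Pchg M (int k) j \<theta>') (sample M (enat (k + m)) -` B \<inter> space (Pchg M (int k) i \<theta>))
      + measure (Pchg M (int k) i \<theta>) ?D"
  proof (rule change_of_measure[OF P(4) P'(4) P(1) P'(1) _ _ B(1) D])
    fix \<omega> assume "\<omega> \<in> space (Pchg M (int k) i \<theta>)"
      and less: "exp (a * real m) * dens_chg M k j \<theta>' (k + m) (sample M (enat (k + m)) \<omega>)
        < dens_chg M k i \<theta> (k + m) (sample M (enat (k + m)) \<omega>)"
    then have \<omega>: "\<omega> \<in> space (Pinf M)" by (simp only: P(3))
    have "ereal (a * real m) \<le> llr M i \<theta> k m \<omega> - llr M j \<theta>' k m \<omega>"
      using llr_diff_ge_of_dens_chg[OF M i \<theta> j \<theta>' m \<omega> exp_gt_zero less] by (simp only: ln_exp)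
    from le_Max_divide[of m a "\<lambda>n. llr M i \<theta> k n \<omega> - llr M j \<theta>' k n \<omega>", OF m this] \<omega>
    show "\<omega> \<in> ?D" by (simp only: P(3) mem_Collect_eq simp_thms)
  qed (simp_all only: P(3) P'(3) exp_ge_zero)
  then show ?thesis by (simp only: B(2) P(3))
qed

lemma Pchg_eq_Pinf_before_change:
  assumes M: "multistream_model M" and i: "i \<in> {1..streams M}" and \<theta>: "\<theta> \<in> param M i"
    and A: "A \<in> sets (obs_filtration M (enat k))"
  shows "measure (Pchg M (int k) i \<theta>) A = measure (Pinf M) A"
proof -
  note P = model_Pchg(1-4)[OF M i \<theta>, of k]
  obtain B where B: "B \<in> sets (sample_base M (enat k))"
    "A = sample M (enat k) -` B \<inter> space (Pinf M)"
    using A unfolding sets_obs_filtration(1)[OF M] by blast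
  have "dens_chg M k i \<theta> k = dens_inf M k" by (simp add: dens_chg_def fun_eq_iff)
  then have "emeasure (Pchg M (int k) i \<theta>) A = emeasure (Pinf M) A"
    using distributed_emeasure[OF P(4) B(1)] distributed_emeasure[OF model_Pinf(2)[OF M] B(1)]
    by (simp only: P(3) B(2))
  then show ?thesis by (simp add: measure_def)
qed

section \<open>Events decided by a rule\<close>

lemma obs_filtration_mono:
  assumes M: "multistream_model M" and kn: "k \<le> n"
  shows "sets (obs_filtration M (enat k)) \<subseteq> sets (obs_filtration M (enat n))"
proof
  fix A assume "A \<in> sets (obs_filtration M (enat k))"
  then obtain B where B: "B \<in> sets (sample_base M (enat k))"
    "A = sample M (enat k) -` B \<inter> space (Pinf M)"
    unfolding sets_obs_filtration(1)[OF M] by blast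
  let ?r = "\<lambda>x. restrict x (sample_idx M (enat k))"
  have sub: "sample_idx M (enat k) \<subseteq> sample_idx M (enat n)"
    using kn by (auto simp: sample_idx_def)
  have r: "?r \<in> sample_base M (enat n) \<rightarrow>\<^sub>M sample_base M (enat k)"
    unfolding sample_base_def by (rule measurable_restrict_subset[OF sub])
  have s: "sample M (enat n) \<in> Pinf M \<rightarrow>\<^sub>M sample_base M (enat n)"
    by (rule distributed_measurable[OF model_Pinf(2)[OF M]])
  have "sample M (enat k) \<omega> = ?r (sample M (enat n) \<omega>)" for \<omega>
    using sub by (auto simp: sample_def restrict_def fun_eq_iff)
  then have "A = sample M (enat n) -` (?r -` B \<inter> space (sample_base M (enat n))) \<inter> space (Pinf M)"
    using B(2) measurable_space[OF s] by auto
  moreover have "?r -` B \<inter> space (sample_base M (enat n)) \<in> sets (sample_base M (enat n))"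
    using r B(1) by (rule measurable_sets)
  ultimately show "A \<in> sets (obs_filtration M (enat n))"
    unfolding sets_obs_filtration(1)[OF M] by blast
qed

lemma space_obs_filtration [simp]: "space (obs_filtration M n) = space (Pinf M)"
  by (simp add: obs_filtration_def)

lemma rule_stop_event:
  assumes "(d, T) \<in> rules M"
  shows "{\<omega> \<in> space (Pinf M). T \<omega> \<le> enat n} \<in> sets (obs_filtration M (enat n))"
  using assms unfolding rules_def stopping_time_def pred_def by simp

lemma rule_decision_event:
  assumes "(d, T) \<in> rules M"
  shows "{\<omega> \<in> space (Pinf M). T \<omega> \<le> enat n \<and> d \<omega> = j} \<in> sets (obs_filtration M (enat n))"
  using assms unfolding rules_def by (simp add: conj_commute)

lemma rule_stop_event_Pinf:
  assumes M: "multistream_model M" and R: "(d, T) \<in> rules M"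
  shows "{\<omega> \<in> space (Pinf M). T \<omega> \<le> enat n} \<in> sets (Pinf M)"
  using rule_stop_event[OF R] sets_obs_filtration(2)[OF M] by blast

lemma rule_stopped_event_Pinf:
  assumes M: "multistream_model M" and R: "(d, T) \<in> rules M"
  shows "{\<omega> \<in> space (Pinf M). Q (d \<omega>) \<and> T \<omega> < \<infinity>} \<in> sets (Pinf M)"
proof -
  have "{\<omega> \<in> space (Pinf M). Q (d \<omega>) \<and> T \<omega> < \<infinity>}
    = (\<Union>j \<in> {j. Q j}. \<Union>n. {\<omega> \<in> space (Pinf M). T \<omega> \<le> enat n \<and> d \<omega> = j})"
    (is "?A = ?B")
  proof (intro set_eqI iffI)
    fix \<omega> assume \<omega>: "\<omega> \<in> ?A"
    then obtain n where "T \<omega> = enat n" by (cases "T \<omega>") auto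
    then show "\<omega> \<in> ?B" using \<omega> by auto
  next
    fix \<omega> assume \<omega>: "\<omega> \<in> ?B"
    then show "\<omega> \<in> ?A" by (cases "T \<omega>") auto
  qed
  moreover have "{\<omega> \<in> space (Pinf M). T \<omega> \<le> enat n \<and> d \<omega> = j} \<in> sets (Pinf M)" for n j
    using rule_decision_event[OF R] sets_obs_filtration(2)[OF M] by blast
  ultimately show ?thesis by (simp add: sets.countable_UN'')
qed

lemma stops_after_nat [simp]: "stops_after \<tau> (int k) \<longleftrightarrow> enat k < \<tau>"
  by (cases \<tau>) (auto simp: stops_after_def)

lemma stops_after_minus_one [simp]: "stops_after \<tau> (-1)"
  by (cases \<tau>) (auto simp: stops_after_def)

lemma stops_after_event_Pinf:
  assumes M: "multistream_model M" and R: "(d, T) \<in> rules M" and k: "-1 \<le> k"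
  shows "{\<omega> \<in> space (Pinf M). stops_after (T \<omega>) k} \<in> sets (Pinf M)"
proof (cases "k = -1")
  case False
  then obtain n where n: "k = int n" using k nonneg_int_cases[of k] by force
  have "{\<omega> \<in> space (Pinf M). stops_after (T \<omega>) k}
    = space (Pinf M) - {\<omega> \<in> space (Pinf M). T \<omega> \<le> enat n}"
    unfolding n by (auto simp: not_le)
  then show ?thesis using rule_stop_event_Pinf[OF M R] by simp
qed simp

section \<open>The prior and the error constraints\<close>

lemma prior_facts:
  assumes "change_prior \<pi>"
  shows "-1 \<le> k \<Longrightarrow> 0 \<le> \<pi> k" "0 < \<pi> (int n)" "A \<subseteq> {-1..} \<Longrightarrow> \<pi> summable_on A"
    "infsum \<pi> {-1..} = 1"
proof -
  show nn: "-1 \<le> k \<Longrightarrow> 0 \<le> \<pi> k" for k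
  proof (cases "k = -1")
    case False
    assume "-1 \<le> k"
    with False have "0 \<le> k" by simp
    then show ?thesis using assms by (simp add: change_prior_def less_imp_le)
  qed (use assms in \<open>simp add: change_prior_def\<close>)
  show "0 < \<pi> (int n)" using assms by (simp add: change_prior_def)
  have hs: "(\<pi> has_sum 1) {-1..}" using assms by (simp add: change_prior_def)
  then show "infsum \<pi> {-1..} = 1" by (rule infsumI)
  show "A \<subseteq> {-1..} \<Longrightarrow> \<pi> summable_on A"
    using has_sum_imp_summable[OF hs] by (rule summable_on_subset_banach)
qed

text \<open>
  The false alarm probabilities are sums of this form with a nondecreasing \<open>p\<close>.  Keeping one term
  controls alarms before a fixed time, and keeping the whole tail gains the factor by which
  the prior enters the asymptotic bound.
\<close>

lemma prior_weighted_suminf: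
  fixes p :: "nat \<Rightarrow> real"
  assumes \<pi>: "change_prior \<pi>" and p: "\<And>k. 0 \<le> p k" "\<And>k. p k \<le> 1"
  shows "summable (\<lambda>k. \<pi> (int k) * p k)" (is ?S)
    and "\<pi> (int k) * p k \<le> (\<Sum>k. \<pi> (int k) * p k)"
    and "(\<And>k. n \<le> k \<Longrightarrow> q \<le> p k) \<Longrightarrow> q * (\<Sum>\<^sub>\<infinity>k \<in> {int n..}. \<pi> k) \<le> (\<Sum>k. \<pi> (int k) * p k)"
proof -
  have nn: "0 \<le> \<pi> (int k)" for k using prior_facts(2)[OF \<pi>, of k] by simp
  have bij: "bij_betw int {n..} {int n..}" for n
    by (rule bij_betwI[where g = nat]) auto
  have "(\<lambda>k. \<pi> (int k)) summable_on {0..}"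
    using summable_on_reindex_bij_betw[OF bij[of 0], of \<pi>] prior_facts(3)[OF \<pi>, of "{0..}"] by simp
  then have s0: "(\<lambda>k. \<pi> (int k)) summable_on UNIV" by (simp add: atLeast_0)
  have "\<pi> (int k) * p k \<le> \<pi> (int k)" for k
    using nn p by (simp add: mult_left_le)
  then have s: "(\<lambda>k. \<pi> (int k) * p k) summable_on UNIV"
    using nn p by (intro summable_on_comparison_test[OF s0]) auto
  then show S: ?S by (rule summable_on_imp_summable)
  show "\<pi> (int k) * p k \<le> (\<Sum>k. \<pi> (int k) * p k)" for k
    using sum_le_suminf[OF S, of "{k}"] nn p by simp
  assume q: "\<And>k. n \<le> k \<Longrightarrow> q \<le> p k"
  have sn: "(\<lambda>k. \<pi> (int k)) summable_on {n..}"
    using s0 by (rule summable_on_subset_banach) auto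
  have "q * (\<Sum>\<^sub>\<infinity>k \<in> {int n..}. \<pi> k) = q * (\<Sum>\<^sub>\<infinity>k \<in> {n..}. \<pi> (int k))"
    using infsum_reindex_bij_betw[OF bij[of n], of \<pi>] by simp
  also have "\<dots> = (\<Sum>\<^sub>\<infinity>k \<in> {n..}. q * \<pi> (int k))"
    using sn by (intro infsum_cmult_right[symmetric]) auto
  also have "\<dots> \<le> (\<Sum>\<^sub>\<infinity>k. \<pi> (int k) * p k)"
  proof (rule infsum_mono_neutral[OF _ s])
    show "(\<lambda>k. q * \<pi> (int k)) summable_on {n..}" using sn by (rule summable_on_cmult_right)
    show "q * \<pi> (int x) \<le> \<pi> (int x) * p x" if "x \<in> {n..} \<inter> UNIV" for x
      using q[of x] nn that by (simp add: mult.commute mult_right_mono)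
  qed (use nn p in auto)
  also have "\<dots> = (\<Sum>k. \<pi> (int k) * p k)"
    by (rule sums_unique[OF has_sum_imp_sums[OF has_sum_infsum[OF s]]])
  finally show "q * (\<Sum>\<^sub>\<infinity>k \<in> {int n..}. \<pi> k) \<le> (\<Sum>k. \<pi> (int k) * p k)" .
qed

lemma prior_tail_pos:
  assumes \<pi>: "change_prior \<pi>"
  shows "0 < (\<Sum>\<^sub>\<infinity>k \<in> {int n..}. \<pi> k)"
proof -
  have "\<pi> (int n) \<le> (\<Sum>\<^sub>\<infinity>k \<in> {int n..}. \<pi> k)"
    using finite_sum_le_infsum[of \<pi> "{int n..}" "{int n}"] prior_facts[OF \<pi>] by auto
  then show ?thesis using prior_facts(2)[OF \<pi>, of n] by simp
qed

lemma PFA_stream_ge: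
  assumes M: "multistream_model M" and \<pi>: "change_prior \<pi>" and R: "(d, T) \<in> rules M"
  shows "\<pi> (int k) * measure (Pinf M) {\<omega> \<in> space (Pinf M). T \<omega> \<le> enat k \<and> d \<omega> = j}
      \<le> PFA_stream M \<pi> j (d, T)"
    and "measure (Pinf M) {\<omega> \<in> space (Pinf M). T \<omega> \<le> enat k \<and> d \<omega> = j}
        * (\<Sum>\<^sub>\<infinity>l \<in> {int k..}. \<pi> l) \<le> PFA_stream M \<pi> j (d, T)"
proof -
  interpret prob_space "Pinf M" by (rule model_Pinf(1)[OF M])
  let ?p = "\<lambda>k. prob {\<omega> \<in> space (Pinf M). T \<omega> \<le> enat k \<and> d \<omega> = j}"
  have ev: "{\<omega> \<in> space (Pinf M). T \<omega> \<le> enat k \<and> d \<omega> = j} \<in> events" for k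
    using rule_decision_event[OF R] sets_obs_filtration(2)[OF M] by blast
  have mono: "?p k \<le> ?p l" if "k \<le> l" for k l
    using that ev by (intro finite_measure_mono) (auto elim: order_trans)
  note w = prior_weighted_suminf[OF \<pi>, of ?p]
  show "\<pi> (int k) * ?p k \<le> PFA_stream M \<pi> j (d, T)"
    using w(2) by (simp add: PFA_stream_def)
  show "?p k * (\<Sum>\<^sub>\<infinity>l \<in> {int k..}. \<pi> l) \<le> PFA_stream M \<pi> j (d, T)"
    using w(3)[of k "?p k"] mono by (simp add: PFA_stream_def)
qed

lemma PFA_stream_le_PFA:
  assumes M: "multistream_model M" and \<pi>: "change_prior \<pi>" and R: "(d, T) \<in> rules M"
  shows "PFA_stream M \<pi> j (d, T) \<le> PFA M \<pi> (d, T)"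
proof -
  interpret prob_space "Pinf M" by (rule model_Pinf(1)[OF M])
  have "prob {\<omega> \<in> space (Pinf M). T \<omega> \<le> enat k \<and> d \<omega> = j} \<le> prob {\<omega> \<in> space (Pinf M). T \<omega> \<le> enat k}" for k
    using rule_stop_event_Pinf[OF M R] by (intro finite_measure_mono) auto
  then show ?thesis
    unfolding PFA_stream_def PFA_def prod.case using prior_facts(2)[OF \<pi>]
    by (intro suminf_le prior_weighted_suminf(1)[OF \<pi>] mult_left_mono) (auto simp: less_imp_le)
qed

lemma PFA_nonneg:
  assumes M: "multistream_model M" and \<pi>: "change_prior \<pi>"
  shows "0 \<le> PFA M \<pi> (d, T)"
proof -
  interpret prob_space "Pinf M" by (rule model_Pinf(1)[OF M])
  show ?thesis
    unfolding PFA_def prod.case using prior_facts(2)[OF \<pi>]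
    by (intro suminf_nonneg prior_weighted_suminf(1)[OF \<pi>]) (auto simp: less_imp_le)
qed

lemma prob_prior_term_le:
  assumes M: "multistream_model M" and \<pi>: "change_prior \<pi>"
    and i: "i \<in> {1..streams M}" and \<theta>: "\<theta> \<in> param M i" and k: "-1 \<le> k"
  shows "\<pi> k * measure (Pchg M k i \<theta>) {\<omega> \<in> space (Pchg M k i \<theta>). E k \<omega>} \<le> prob_prior M \<pi> i \<theta> E"
    and "0 \<le> prob_prior M \<pi> i \<theta> E" "prob_prior M \<pi> i \<theta> E \<le> 1"
    and "(\<lambda>k. \<pi> k * measure (Pchg M k i \<theta>) {\<omega> \<in> space (Pchg M k i \<theta>). E k \<omega>}) summable_on {-1..}"
proof -
  let ?f = "\<lambda>k. \<pi> k * measure (Pchg M k i \<theta>) {\<omega> \<in> space (Pchg M k i \<theta>). E k \<omega>}"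
  have f: "0 \<le> ?f k" "?f k \<le> \<pi> k" if "-1 \<le> k" for k
    using prior_facts(1)[OF \<pi> that]
      prob_space.prob_le_1[OF model_Pchg_from_minus_one(1)[OF M i \<theta> that]]
    by (auto simp: mult_left_le)
  show s: "?f summable_on {-1..}"
    by (rule summable_on_comparison_test[OF prior_facts(3)[OF \<pi> order_refl]]) (use f in auto)
  show "?f k \<le> prob_prior M \<pi> i \<theta> E"
    using finite_sum_le_infsum[OF s, of "{k}"] f k by (auto simp: prob_prior_def)
  show "0 \<le> prob_prior M \<pi> i \<theta> E"
    unfolding prob_prior_def using f by (intro infsum_nonneg) auto
  have "prob_prior M \<pi> i \<theta> E \<le> infsum \<pi> {-1..}"
    unfolding prob_prior_def using f by (intro infsum_mono s prior_facts(3)[OF \<pi>]) auto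
  then show "prob_prior M \<pi> i \<theta> E \<le> 1" using prior_facts(4)[OF \<pi>] by simp
qed

lemma prob_prior_mono:
  assumes M: "multistream_model M" and \<pi>: "change_prior \<pi>"
    and i: "i \<in> {1..streams M}" and \<theta>: "\<theta> \<in> param M i"
    and F: "\<And>k. -1 \<le> k \<Longrightarrow> {\<omega> \<in> space (Pinf M). F k \<omega>} \<in> sets (Pinf M)"
    and EF: "\<And>k \<omega>. \<omega> \<in> space (Pinf M) \<Longrightarrow> E k \<omega> \<Longrightarrow> F k \<omega>"
  shows "prob_prior M \<pi> i \<theta> E \<le> prob_prior M \<pi> i \<theta> F"
  unfolding prob_prior_def
proof (intro infsum_mono prob_prior_term_le(4)[OF M \<pi> i \<theta>, of 0])
  fix k :: int assume "k \<in> {-1..}"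
  then have k: "-1 \<le> k" by simp
  note P = model_Pchg_from_minus_one[OF M i \<theta> k]
  have "measure (Pchg M k i \<theta>) {\<omega> \<in> space (Pchg M k i \<theta>). E k \<omega>}
      \<le> measure (Pchg M k i \<theta>) {\<omega> \<in> space (Pchg M k i \<theta>). F k \<omega>}"
    using F[OF k] EF P
    by (intro finite_measure.finite_measure_mono prob_space.finite_measure) auto
  then show "\<pi> k * measure (Pchg M k i \<theta>) {\<omega> \<in> space (Pchg M k i \<theta>). E k \<omega>}
      \<le> \<pi> k * measure (Pchg M k i \<theta>) {\<omega> \<in> space (Pchg M k i \<theta>). F k \<omega>}"
    using prior_facts(1)[OF \<pi> k] by (rule mult_left_mono)
qed auto

text \<open>
  The quotients are conditional probabilities, or \<open>0\<close> if the condition has probability \<open>0\<close>.  The bound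
  is what makes the real-valued suprema of the misidentification probabilities dominate their entries.
\<close>

lemma conditional_error_bdd:
  assumes M: "multistream_model M" and \<pi>: "change_prior \<pi>" and R: "(d, T) \<in> rules M"
    and i: "i \<in> {1..streams M}"
  shows "bdd_above ((\<lambda>\<theta>. prob_prior M \<pi> i \<theta> (\<lambda>k \<omega>. E k \<omega> \<and> stops_after (T \<omega>) k)
       / prob_prior M \<pi> i \<theta> (\<lambda>k \<omega>. stops_after (T \<omega>) k)) ` param M i)"
proof (rule bdd_aboveI2)
  fix \<theta> assume \<theta>: "\<theta> \<in> param M i"
  have "prob_prior M \<pi> i \<theta> (\<lambda>k \<omega>. E k \<omega> \<and> stops_after (T \<omega>) k)
      \<le> prob_prior M \<pi> i \<theta> (\<lambda>k \<omega>. stops_after (T \<omega>) k)"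
    by (rule prob_prior_mono[OF M \<pi> i \<theta> stops_after_event_Pinf[OF M R]]) auto
  then show "prob_prior M \<pi> i \<theta> (\<lambda>k \<omega>. E k \<omega> \<and> stops_after (T \<omega>) k)
       / prob_prior M \<pi> i \<theta> (\<lambda>k \<omega>. stops_after (T \<omega>) k) \<le> 1"
    using prob_prior_term_le(2)[OF M \<pi> i \<theta>, of 0] by (intro divide_le_eq_1[THEN iffD2]) (force simp: less_le)
qed

text \<open>
  Drop the conditioning, which only divides by a number at most \<open>1\<close>, and keep the single change
  point \<open>k\<close> of the prior.
\<close>

lemma PMI_pair_ge:
  assumes M: "multistream_model M" and \<pi>: "change_prior \<pi>" and R: "(d, T) \<in> rules M"
    and i: "i \<in> {1..streams M}" and \<theta>: "\<theta> \<in> param M i"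
    and b: "PMI_pair M \<pi> i j (d, T) \<le> b" "0 \<le> b"
  shows "\<pi> (int k) * measure (Pchg M (int k) i \<theta>)
      {\<omega> \<in> space (Pinf M). d \<omega> = j \<and> T \<omega> < \<infinity> \<and> enat k < T \<omega>} \<le> b"
proof -
  let ?E = "\<lambda>k \<omega>. (d \<omega> = j \<and> T \<omega> < \<infinity>) \<and> stops_after (T \<omega>) k"
  let ?F = "\<lambda>k \<omega>. stops_after (T \<omega>) k"
  have le: "prob_prior M \<pi> i \<theta> ?E \<le> prob_prior M \<pi> i \<theta> ?F"
    by (rule prob_prior_mono[OF M \<pi> i \<theta> stops_after_event_Pinf[OF M R]]) auto
  have "prob_prior M \<pi> i \<theta> ?E / prob_prior M \<pi> i \<theta> ?F
      \<le> (SUP \<theta> \<in> param M i. prob_prior M \<pi> i \<theta> ?E / prob_prior M \<pi> i \<theta> ?F)"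
    using conditional_error_bdd[OF M \<pi> R i, of "\<lambda>k \<omega>. d \<omega> = j \<and> T \<omega> < \<infinity>"] \<theta> by (rule cSUP_upper2) simp
  also have "\<dots> \<le> b" using b(1) by (simp add: PMI_pair_def conj_assoc)
  finally have q: "prob_prior M \<pi> i \<theta> ?E / prob_prior M \<pi> i \<theta> ?F \<le> b" .
  have F: "0 \<le> prob_prior M \<pi> i \<theta> ?F" "prob_prior M \<pi> i \<theta> ?F \<le> 1"
    by (rule prob_prior_term_le[OF M \<pi> i \<theta>, of 0]; simp)+
  have "prob_prior M \<pi> i \<theta> ?E \<le> b"
  proof (cases "prob_prior M \<pi> i \<theta> ?F = 0")
    case False
    then have "prob_prior M \<pi> i \<theta> ?E \<le> b * prob_prior M \<pi> i \<theta> ?F"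
      using q F by (simp add: field_simps)
    also have "\<dots> \<le> b" using F b(2) by (simp add: mult_left_le)
    finally show ?thesis .
  qed (use le b in simp)
  moreover have "\<pi> (int k) * measure (Pchg M (int k) i \<theta>)
      {\<omega> \<in> space (Pchg M (int k) i \<theta>). ?E (int k) \<omega>} \<le> prob_prior M \<pi> i \<theta> ?E"
    by (rule prob_prior_term_le(1)[OF M \<pi> i \<theta>]) simp
  ultimately show ?thesis
    by (simp add: model_Pchg(3)[OF M i \<theta>] conj_assoc)
qed

lemma PMI_pair_le_PMI:
  assumes M: "multistream_model M" and \<pi>: "change_prior \<pi>" and R: "(d, T) \<in> rules M"
    and i: "i \<in> {1..streams M}" and j: "j \<noteq> i"
  shows "PMI_pair M \<pi> i j (d, T) \<le> PMI M \<pi> i (d, T)"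
proof -
  let ?E = "\<lambda>k \<omega>. (d \<omega> = j \<and> T \<omega> < \<infinity>) \<and> stops_after (T \<omega>) k"
  let ?G = "\<lambda>k \<omega>. (d \<omega> \<noteq> i \<and> T \<omega> < \<infinity>) \<and> stops_after (T \<omega>) k"
  let ?F = "\<lambda>k \<omega>. stops_after (T \<omega>) k"
  have G: "{\<omega> \<in> space (Pinf M). ?G k \<omega>} \<in> sets (Pinf M)" if "-1 \<le> k" for k
    using sets.Int[OF rule_stopped_event_Pinf[OF M R, of "\<lambda>l. l \<noteq> i"] stops_after_event_Pinf[OF M R that]]
    by (rule back_subst[of "\<lambda>A. A \<in> sets (Pinf M)"]) auto
  have "prob_prior M \<pi> i \<theta> ?E / prob_prior M \<pi> i \<theta> ?F \<le> prob_prior M \<pi> i \<theta> ?G / prob_prior M \<pi> i \<theta> ?F"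
    if \<theta>: "\<theta> \<in> param M i" for \<theta>
    by (intro divide_right_mono prob_prior_mono[OF M \<pi> i \<theta> G] prob_prior_term_le(2)[OF M \<pi> i \<theta>, of 0])
      (use j in auto)
  then have "(SUP \<theta> \<in> param M i. prob_prior M \<pi> i \<theta> ?E / prob_prior M \<pi> i \<theta> ?F)
      \<le> (SUP \<theta> \<in> param M i. prob_prior M \<pi> i \<theta> ?G / prob_prior M \<pi> i \<theta> ?F)"
    using M i conditional_error_bdd[OF M \<pi> R i, of "\<lambda>k \<omega>. d \<omega> \<noteq> i \<and> T \<omega> < \<infinity>"]
    by (intro cSUP_mono) (auto simp: multistream_model_def)
  then show ?thesis by (simp add: PMI_pair_def PMI_def conj_assoc)
qed

lemma rule_class_star_subset:
  assumes M: "multistream_model M" and \<pi>: "change_prior \<pi>"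
  shows "rule_class_star M \<pi> \<alpha> \<beta> \<subseteq> rule_class M \<pi> (\<lambda>_. \<alpha>) (\<lambda>i _. \<beta> i)"
proof
  fix \<delta> assume "\<delta> \<in> rule_class_star M \<pi> \<alpha> \<beta>"
  moreover obtain d T where \<delta>: "\<delta> = (d, T)" by (cases \<delta>)
  ultimately have R: "(d, T) \<in> rules M" and *: "PFA M \<pi> (d, T) \<le> \<alpha>"
    "\<And>i. i \<in> {1..streams M} \<Longrightarrow> PMI M \<pi> i (d, T) \<le> \<beta> i"
    by (auto simp: rule_class_star_def)
  have "PFA_stream M \<pi> j (d, T) \<le> \<alpha>" for j
    using PFA_stream_le_PFA[OF M \<pi> R, of j] *(1) by simp
  moreover have "PMI_pair M \<pi> i j (d, T) \<le> \<beta> i" if "i \<in> {1..streams M}" "j \<in> {1..streams M} - {i}" for i j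
  proof -
    have "PMI_pair M \<pi> i j (d, T) \<le> PMI M \<pi> i (d, T)"
      using that by (intro PMI_pair_le_PMI[OF M \<pi> R]) auto
    then show ?thesis using *(2)[OF that(1)] by simp
  qed
  ultimately show "\<delta> \<in> rule_class M \<pi> (\<lambda>_. \<alpha>) (\<lambda>i _. \<beta> i)"
    using R by (simp add: rule_class_def \<delta>)
qed

section \<open>Early correct identification is improbable\<close>

text \<open>
  Markov's inequality.  A loss of less than \<open>(m + 1)\<^sup>r\<close> requires to stop by time \<open>k\<close>, to
  name a wrong stream after \<open>k\<close>, or to name \<open>i\<close> between \<open>k\<close> and \<open>k + m\<close>; never stopping costs
  \<open>\<infinity>\<close>.  The first event belongs to the sigma-algebra at time \<open>k\<close>, where the law with a change at
  \<open>k\<close> agrees with \<open>Pinf M\<close>.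
\<close>

lemma delay_moment_ge:
  assumes M: "multistream_model M" and R: "(d, T) \<in> rules M"
    and i: "i \<in> {1..streams M}" and \<theta>: "\<theta> \<in> param M i" and r: "0 < r"
  shows "ennreal (real (m + 1) powr r
      * (1 - measure (Pinf M) {\<omega> \<in> space (Pinf M). T \<omega> \<le> enat k}
           - (\<Sum>j \<in> {1..streams M} - {i}.
                measure (Pchg M (int k) i \<theta>) {\<omega> \<in> space (Pinf M). d \<omega> = j \<and> T \<omega> < \<infinity> \<and> enat k < T \<omega>})
           - measure (Pchg M (int k) i \<theta>) {\<omega> \<in> space (Pinf M). (T \<omega> \<le> enat (k + m) \<and> d \<omega> = i) \<and> enat k < T \<omega>}))
    \<le> delay_moment M r (int k) i \<theta> (d, T)"
proof -
  define P where "P = Pchg M (int k) i \<theta>"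
  interpret P: prob_space P unfolding P_def by (rule model_Pchg(1)[OF M i \<theta>])
  have sets: "sets P = sets (Pinf M)" and space: "space P = space (Pinf M)"
    unfolding P_def by (rule model_Pchg(2,3)[OF M i \<theta>])+
  let ?\<Omega> = "space (Pinf M)"
  let ?G = "{\<omega> \<in> ?\<Omega>. enat (k + m) < T \<omega> \<and> (T \<omega> < \<infinity> \<longrightarrow> d \<omega> = i)}"
  let ?E = "{\<omega> \<in> ?\<Omega>. T \<omega> \<le> enat k}"
  let ?W = "\<lambda>j. {\<omega> \<in> ?\<Omega>. d \<omega> = j \<and> T \<omega> < \<infinity> \<and> enat k < T \<omega>}"
  let ?H = "{\<omega> \<in> ?\<Omega>. (T \<omega> \<le> enat (k + m) \<and> d \<omega> = i) \<and> enat k < T \<omega>}"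
  let ?J = "{1..streams M} - {i}"
  have stop: "{\<omega> \<in> ?\<Omega>. T \<omega> \<le> enat n} \<in> sets P" for n
    using rule_stop_event_Pinf[OF M R] by (simp only: sets)
  have dec: "{\<omega> \<in> ?\<Omega>. Q (d \<omega>) \<and> T \<omega> < \<infinity>} \<in> sets P" for Q
    using rule_stopped_event_Pinf[OF M R] by (simp only: sets)
  have top: "?\<Omega> \<in> sets P" using sets.top[of "Pinf M"] by (simp only: sets)
  have "?G = ?\<Omega> - ({\<omega> \<in> ?\<Omega>. T \<omega> \<le> enat (k + m)} \<union> {\<omega> \<in> ?\<Omega>. d \<omega> \<noteq> i \<and> T \<omega> < \<infinity>})"
    unfolding not_le[symmetric] by blast
  also have "\<dots> \<in> sets P" using top stop dec[of "\<lambda>j. j \<noteq> i"] by (intro sets.Diff sets.Un)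
  finally have G: "?G \<in> sets P" .
  have W: "?W j \<in> sets P" for j
  proof -
    have "?W j = {\<omega> \<in> ?\<Omega>. d \<omega> = j \<and> T \<omega> < \<infinity>} - ?E"
      unfolding not_le[symmetric] by blast
    also have "\<dots> \<in> sets P" using stop dec[of "\<lambda>l. l = j"] by (intro sets.Diff)
    finally show ?thesis .
  qed
  have "?H = {\<omega> \<in> ?\<Omega>. T \<omega> \<le> enat (k + m)} \<inter> ?W i"
    using le_less_trans[of _ "enat (k + m)" \<infinity>] by auto
  also have "\<dots> \<in> sets P" by (intro sets.Int stop W)
  finally have H: "?H \<in> sets P" .
  have UW: "(\<Union>j \<in> ?J. ?W j) \<in> sets P" using W by (intro sets.finite_UN) auto
  have d: "d \<omega> \<in> {1..streams M}" if "\<omega> \<in> ?\<Omega>" for \<omega> using R that by (auto simp: rules_def)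
  have cover: "?\<Omega> \<subseteq> ((?G \<union> ?E) \<union> (\<Union>j \<in> ?J. ?W j)) \<union> ?H"
  proof
    fix \<omega> assume \<omega>: "\<omega> \<in> ?\<Omega>"
    show "\<omega> \<in> ((?G \<union> ?E) \<union> (\<Union>j \<in> ?J. ?W j)) \<union> ?H"
      using \<omega> d[OF \<omega>] by (cases "T \<omega>"; cases "d \<omega> = i") auto
  qed
  have "1 = measure P ?\<Omega>" using P.prob_space by (simp only: space)
  also have "\<dots> \<le> measure P (((?G \<union> ?E) \<union> (\<Union>j \<in> ?J. ?W j)) \<union> ?H)"
    using cover G stop UW H by (intro P.finite_measure_mono sets.Un)
  also have "\<dots> \<le> measure P ((?G \<union> ?E) \<union> (\<Union>j \<in> ?J. ?W j)) + measure P ?H"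
    by (intro measure_Un_le sets.Un G stop UW H)
  also have "measure P ((?G \<union> ?E) \<union> (\<Union>j \<in> ?J. ?W j))
      \<le> measure P (?G \<union> ?E) + measure P (\<Union>j \<in> ?J. ?W j)"
    by (intro measure_Un_le sets.Un G stop UW)
  also have "measure P (?G \<union> ?E) \<le> measure P ?G + measure P ?E"
    by (intro measure_Un_le G stop)
  also have "measure P (\<Union>j \<in> ?J. ?W j) \<le> (\<Sum>j \<in> ?J. measure P (?W j))"
    using W by (intro P.finite_measure_subadditive_finite) auto
  finally have "1 - measure P ?E - (\<Sum>j \<in> ?J. measure P (?W j)) - measure P ?H \<le> measure P ?G"
    by simp
  moreover have "measure P ?E = measure (Pinf M) ?E"
    unfolding P_def by (rule Pchg_eq_Pinf_before_change[OF M i \<theta> rule_stop_event[OF R]])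
  ultimately have le: "1 - measure (Pinf M) ?E - (\<Sum>j \<in> ?J. measure P (?W j)) - measure P ?H
    \<le> measure P ?G" by simp
  have "ennreal (real (m + 1) powr r
      * (1 - measure (Pinf M) ?E - (\<Sum>j \<in> ?J. measure P (?W j)) - measure P ?H))
    \<le> ennreal (real (m + 1) powr r * measure P ?G)"
    using le by (intro ennreal_leI mult_left_mono) auto
  also have "\<dots> = ennreal (real (m + 1) powr r) * emeasure P ?G"
    by (simp add: ennreal_mult P.emeasure_eq_measure)
  also have "\<dots> = (\<integral>\<^sup>+ \<omega>. ennreal (real (m + 1) powr r) * indicator ?G \<omega> \<partial>P)"
    using G by (simp add: nn_integral_cmult_indicator)
  also have "\<dots> \<le> (\<integral>\<^sup>+ \<omega>. delay_loss r (int k) i (d \<omega>) (T \<omega>) * indicator {\<omega>. stops_after (T \<omega>) (int k)} \<omega> \<partial>P)"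
  proof (intro nn_integral_mono)
    fix \<omega>
    show "ennreal (real (m + 1) powr r) * indicator ?G \<omega>
      \<le> delay_loss r (int k) i (d \<omega>) (T \<omega>) * indicator {\<omega>. stops_after (T \<omega>) (int k)} \<omega>"
    proof (cases "\<omega> \<in> ?G")
      case True
      then have a: "enat k < T \<omega>" by (cases "T \<omega>") auto
      have "ennreal (real (m + 1) powr r) \<le> delay_loss r (int k) i (d \<omega>) (T \<omega>)"
      proof (cases "T \<omega>")
        case (enat n)
        then have n: "k + m < n" "d \<omega> = i" using True by auto
        then have "real (m + 1) powr r \<le> (real n - real k) powr r"
          using r by (intro powr_mono2) auto
        then show ?thesis using enat n by (simp add: delay_loss_def ennreal_leI)
      qed (simp add: delay_loss_def)
      then show ?thesis using True a by simp
    qed simp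
  qed
  finally show ?thesis by (simp add: delay_moment_def P_def)
qed

lemma exp_linear_tendsto_0:
  fixes a b :: real
  assumes "0 < b"
  shows "(\<lambda>m. exp (a - b * real m)) \<longlonglongrightarrow> 0"
proof -
  have "(\<lambda>m. exp a * exp (- b) ^ m) \<longlonglongrightarrow> exp a * 0"
    using assms by (intro tendsto_mult tendsto_const LIMSEQ_realpow_zero) auto
  then show ?thesis
    by (simp add: exp_diff exp_minus exp_of_nat2_mult divide_inverse power_inverse)
qed

lemma le_mult_expI:
  fixes a b x :: real
  assumes "x * exp (- a) \<le> b"
  shows "x \<le> b * exp a"
proof -
  have "x * exp (- a) * exp a \<le> b * exp a"
    using assms by (intro mult_right_mono) auto
  then show ?thesis by (simp add: mult.assoc flip: exp_add)
qed

lemma le_exp_of_ln_bound: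
  fixes a m J s :: real
  assumes "0 < a" "a < 1" "0 < s" "m * J \<le> s * \<bar>ln a\<bar>"
  shows "a \<le> exp (- (m * (J / s)))"
proof -
  have "m * J / s \<le> \<bar>ln a\<bar>" using assms(3,4) by (simp add: pos_divide_le_eq mult.commute)
  then have "ln a \<le> - (m * (J / s))" using assms(1,2) by simp
  then have "exp (ln a) \<le> exp (- (m * (J / s)))" by (simp only: exp_le_cancel_iff)
  then show ?thesis using assms(1) by (simp only: exp_ln)
qed

lemma eq_add_three_times_third: "y = (x - z) / 3 \<Longrightarrow> x = z + 3 * y" for x y z :: real
  by simp

text \<open>
  The hypothesis on \<open>m\<close> says \<open>\<alpha> i \<le> exp (- m J / s)\<close> with \<open>J = I0 i \<theta> + \<mu>\<close>.  As \<open>s < 1\<close>, the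
  exponent exceeds \<open>m J\<close> by \<open>3 \<rho> m\<close>; of this margin one \<open>\<rho>\<close> is spent on the information number, one on
  the decay rate of the prior, and the third one makes the bound tend to \<open>0\<close>.  The estimate depends on
  the error bounds only through \<open>m\<close>, so it is uniform over all bounds and rules.
\<close>

lemma eventually_early_alarm_small_by_PFA:
  assumes M: "multistream_model M" and \<mu>: "0 \<le> \<mu>" and prior: "\<pi> \<in> prior_class \<mu>"
    and C1: "condition_C1 M I0 I" and i: "i \<in> {1..streams M}" and \<theta>: "\<theta> \<in> param M i"
    and I0: "0 < I0 i \<theta>" and s: "0 < s" "s < 1" and \<eta>: "0 < \<eta>"
  shows "\<forall>\<^sub>F m in sequentially. \<forall>\<alpha> \<beta> d T. (d, T) \<in> rule_class M \<pi> \<alpha> \<beta> \<longrightarrow> 0 < \<alpha> i \<longrightarrow> \<alpha> i < 1 \<longrightarrow>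
     real m * (I0 i \<theta> + \<mu>) \<le> s * \<bar>ln (\<alpha> i)\<bar> \<longrightarrow>
     measure (Pchg M (int k) i \<theta>) {\<omega> \<in> space (Pinf M). T \<omega> \<le> enat (k + m) \<and> d \<omega> = i} \<le> \<eta>"
proof -
  have \<pi>: "change_prior \<pi>" using prior by (simp add: prior_class_def)
  define J where "J = I0 i \<theta> + \<mu>"
  define \<rho> where "\<rho> = (J / s - J) / 3"
  have J: "0 < J" using I0 \<mu> by (simp add: J_def)
  have \<rho>: "0 < \<rho>" using J s by (simp add: \<rho>_def field_simps)
  define tail where "tail n = (\<Sum>\<^sub>\<infinity>l \<in> {int n + 1..}. \<pi> l)" for n
  have tail: "0 < tail n" for n
    using prior_tail_pos[OF \<pi>, of "Suc n"] by (simp add: tail_def add.commute)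
  have tail_mono: "tail n \<le> (\<Sum>\<^sub>\<infinity>l \<in> {int n..}. \<pi> l)" for n
    unfolding tail_def using prior_facts[OF \<pi>] by (intro infsum_mono_neutral) auto
  let ?C = "\<lambda>m. measure (Pchg M (int k) i \<theta>) {\<omega> \<in> space (Pchg M (int k) i \<theta>).
      ereal (I0 i \<theta> + \<rho>) \<le> (MAX n \<in> {1..m}. llr M i \<theta> k n \<omega>) / ereal (real m)}"
  have eq: "(1 + \<rho> / I0 i \<theta>) * I0 i \<theta> = I0 i \<theta> + \<rho>" and pos: "0 < \<rho> / I0 i \<theta>"
    using I0 \<rho> by (auto simp: field_simps)
  have C: "?C \<longlonglongrightarrow> 0"
    by (rule C1[unfolded condition_C1_def, THEN spec, THEN mp, OF pos, THEN spec, THEN bspec, OF i,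
          THEN bspec, OF \<theta>, THEN conjunct1, unfolded eq])
  have "(\<lambda>m. exp ((\<mu> + \<rho>) * real k - \<rho> * real m) + ?C m) \<longlonglongrightarrow> 0 + 0"
    by (intro tendsto_add exp_linear_tendsto_0 \<rho> C)
  then have small: "\<forall>\<^sub>F m in sequentially. exp ((\<mu> + \<rho>) * real k - \<rho> * real m) + ?C m < \<eta>"
    using \<eta> by (intro order_tendstoD) auto
  have "(\<lambda>n. \<bar>ln (tail n)\<bar> / real n) \<longlonglongrightarrow> \<mu>"
    using prior by (simp add: prior_class_def tail_def)
  then have "\<forall>\<^sub>F n in sequentially. \<bar>ln (tail n)\<bar> / real n < \<mu> + \<rho>"
    using \<rho> by (intro order_tendstoD) auto
  then obtain n0 where n0: "\<And>n. n0 \<le> n \<Longrightarrow> \<bar>ln (tail n)\<bar> / real n < \<mu> + \<rho>"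
    by (auto simp: eventually_sequentially)
  show ?thesis
    using small eventually_ge_at_top[of "max 1 n0"]
  proof eventually_elim
    case (elim m)
    show ?case
    proof (intro allI impI)
      fix \<alpha> \<beta> d T
      assume cls: "(d, T) \<in> rule_class M \<pi> \<alpha> \<beta>" and \<alpha>: "0 < \<alpha> i" "\<alpha> i < 1"
        and m\<alpha>: "real m * (I0 i \<theta> + \<mu>) \<le> s * \<bar>ln (\<alpha> i)\<bar>"
      have R: "(d, T) \<in> rules M" and pfa: "PFA_stream M \<pi> i (d, T) \<le> \<alpha> i"
        using cls i by (auto simp: rule_class_def)
      let ?A = "{\<omega> \<in> space (Pinf M). T \<omega> \<le> enat (k + m) \<and> d \<omega> = i}"
      have m: "1 \<le> m" using elim by simp
      have "measure (Pinf M) ?A * tail (k + m) \<le> measure (Pinf M) ?A * (\<Sum>\<^sub>\<infinity>l \<in> {int (k + m)..}. \<pi> l)"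
        by (intro mult_left_mono tail_mono measure_nonneg)
      also have "\<dots> \<le> PFA_stream M \<pi> i (d, T)"
        by (rule PFA_stream_ge(2)[OF M \<pi> R])
      also note pfa
      finally have A: "measure (Pinf M) ?A * tail (k + m) \<le> \<alpha> i" .
      have "\<bar>ln (tail (k + m))\<bar> < (\<mu> + \<rho>) * real (k + m)"
        using n0[of "k + m"] elim m by (simp add: divide_less_eq)
      then have "- ((\<mu> + \<rho>) * real (k + m)) \<le> ln (tail (k + m))" by linarith
      then have t: "exp (- ((\<mu> + \<rho>) * real (k + m))) \<le> tail (k + m)"
        using tail by (simp add: ln_ge_iff)
      have a: "\<alpha> i \<le> exp (- (real m * (J / s)))"
        by (rule le_exp_of_ln_bound[OF \<alpha> s(1) m\<alpha>[folded J_def]])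
      have "measure (Pinf M) ?A * exp (- ((\<mu> + \<rho>) * real (k + m))) \<le> measure (Pinf M) ?A * tail (k + m)"
        using t by (intro mult_left_mono) auto
      also note A
      also note a
      finally have "measure (Pinf M) ?A \<le> exp (- (real m * (J / s))) * exp ((\<mu> + \<rho>) * real (k + m))"
        by (rule le_mult_expI)
      then have "exp ((I0 i \<theta> + \<rho>) * real m) * measure (Pinf M) ?A
          \<le> exp ((I0 i \<theta> + \<rho>) * real m) * (exp (- (real m * (J / s))) * exp ((\<mu> + \<rho>) * real (k + m)))"
        by (intro mult_left_mono) auto
      also have "\<dots> = exp ((\<mu> + \<rho>) * real k - \<rho> * real m)"
      proof -
        have Js: "J / s = J + 3 * \<rho>" by (rule eq_add_three_times_third[OF \<rho>_def])
        show ?thesis unfolding exp_add[symmetric] Js exp_inj_iff by (simp add: J_def algebra_simps)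
      qed
      finally have "exp ((I0 i \<theta> + \<rho>) * real m) * measure (Pinf M) ?A
          \<le> exp ((\<mu> + \<rho>) * real k - \<rho> * real m)" .
      moreover have "measure (Pchg M (int k) i \<theta>) ?A
          \<le> exp ((I0 i \<theta> + \<rho>) * real m) * measure (Pinf M) ?A + ?C m"
        by (rule Pchg_le_Pinf[OF M i \<theta> m rule_decision_event[OF R]])
      ultimately show "measure (Pchg M (int k) i \<theta>) ?A \<le> \<eta>" using elim(1) by linarith
    qed
  qed
qed

text \<open>
  As before with margin \<open>3 \<rho> m\<close>, where \<open>J\<close> is now the infimum: one \<open>\<rho>\<close> pays for choosing a
  parameter \<open>\<theta>'\<close> close to the infimum and one for the \<open>\<epsilon>\<close> of condition C1.  The prior contributes only
  the constant \<open>\<pi> k\<close>, because both laws have the same change point.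
\<close>

lemma eventually_early_alarm_small_by_PMI:
  assumes M: "multistream_model M" and \<pi>: "change_prior \<pi>"
    and C1: "condition_C1 M I0 I" and i: "i \<in> {1..streams M}" and \<theta>: "\<theta> \<in> param M i"
    and j: "j \<in> {1..streams M} - {i}" and pos: "\<And>\<theta>'. \<theta>' \<in> param M j \<Longrightarrow> 0 < I i j \<theta> \<theta>'"
    and J: "0 < (INF \<theta>' \<in> param M j. I i j \<theta> \<theta>')" and s: "0 < s" "s < 1" and \<eta>: "0 < \<eta>"
  shows "\<forall>\<^sub>F m in sequentially. \<forall>\<alpha> \<beta> d T. (d, T) \<in> rule_class M \<pi> \<alpha> \<beta> \<longrightarrow> 0 < \<beta> j i \<longrightarrow> \<beta> j i < 1 \<longrightarrow>
     real m * (INF \<theta>' \<in> param M j. I i j \<theta> \<theta>') \<le> s * \<bar>ln (\<beta> j i)\<bar> \<longrightarrow>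
     measure (Pchg M (int k) i \<theta>)
       {\<omega> \<in> space (Pinf M). (T \<omega> \<le> enat (k + m) \<and> d \<omega> = i) \<and> enat k < T \<omega>} \<le> \<eta>"
proof -
  define J where "J = (INF \<theta>' \<in> param M j. I i j \<theta> \<theta>')"
  define \<rho> where "\<rho> = (J / s - J) / 3"
  have J: "0 < J" using J by (simp add: J_def)
  have \<rho>: "0 < \<rho>" using J s by (simp add: \<rho>_def field_simps)
  have j': "j \<in> {1..streams M}" using j by simp
  have ne: "param M j \<noteq> {}" using M j' by (auto simp: multistream_model_def)
  have "\<exists>x \<in> I i j \<theta> ` param M j. x < J + \<rho>"
    by (rule cInf_lessD) (use ne \<rho> in \<open>simp_all add: J_def\<close>)
  then obtain \<theta>' where \<theta>': "\<theta>' \<in> param M j" "I i j \<theta> \<theta>' < J + \<rho>"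
    by blast
  let ?I = "I i j \<theta> \<theta>'"
  have I: "0 < ?I" by (rule pos[OF \<theta>'(1)])
  let ?C = "\<lambda>m. measure (Pchg M (int k) i \<theta>) {\<omega> \<in> space (Pchg M (int k) i \<theta>).
      ereal (?I + \<rho>) \<le> (MAX n \<in> {1..m}. llr M i \<theta> k n \<omega> - llr M j \<theta>' k n \<omega>) / ereal (real m)}"
  have eq: "(1 + \<rho> / ?I) * ?I = ?I + \<rho>" and pos': "0 < \<rho> / ?I"
    using I \<rho> by (auto simp: field_simps)
  have C: "?C \<longlonglongrightarrow> 0"
    by (rule C1[unfolded condition_C1_def, THEN spec, THEN mp, OF pos', THEN spec, THEN bspec, OF i,
          THEN bspec, OF \<theta>, THEN conjunct2, THEN bspec, OF j, THEN bspec, OF \<theta>'(1), unfolded eq])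
  have pk: "0 < \<pi> (int k)" by (rule prior_facts(2)[OF \<pi>])
  have "(\<lambda>m. exp (- ln (\<pi> (int k)) - \<rho> * real m) + ?C m) \<longlonglongrightarrow> 0 + 0"
    by (intro tendsto_add exp_linear_tendsto_0 \<rho> C)
  then have small: "\<forall>\<^sub>F m in sequentially. exp (- ln (\<pi> (int k)) - \<rho> * real m) + ?C m < \<eta>"
    using \<eta> by (intro order_tendstoD) auto
  show ?thesis
    using small eventually_ge_at_top[of 1]
  proof eventually_elim
    case (elim m)
    show ?case
    proof (intro allI impI)
      fix \<alpha> \<beta> d T
      assume cls: "(d, T) \<in> rule_class M \<pi> \<alpha> \<beta>" and \<beta>: "0 < \<beta> j i" "\<beta> j i < 1"
        and m\<beta>: "real m * (INF \<theta>' \<in> param M j. I i j \<theta> \<theta>') \<le> s * \<bar>ln (\<beta> j i)\<bar>"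
      have R: "(d, T) \<in> rules M" and pmi: "PMI_pair M \<pi> j i (d, T) \<le> \<beta> j i"
        using cls i j by (auto simp: rule_class_def)
      let ?A = "{\<omega> \<in> space (Pinf M). (T \<omega> \<le> enat (k + m) \<and> d \<omega> = i) \<and> enat k < T \<omega>}"
      let ?B = "{\<omega> \<in> space (Pinf M). d \<omega> = i \<and> T \<omega> < \<infinity> \<and> enat k < T \<omega>}"
      note Pj = model_Pchg(1-3)[OF M j' \<theta>'(1), of k]
      interpret Pj: prob_space "Pchg M (int k) j \<theta>'" by (rule Pj(1))
      have "?A = {\<omega> \<in> space (Pinf M). T \<omega> \<le> enat (k + m) \<and> d \<omega> = i}
          - {\<omega> \<in> space (Pinf M). T \<omega> \<le> enat k}"
        by (auto simp: not_le)
      moreover have "\<dots> \<in> sets (obs_filtration M (enat (k + m)))"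
        using rule_decision_event[OF R] rule_stop_event[OF R]
          obs_filtration_mono[OF M le_add1[of k m]] by (intro sets.Diff) auto
      ultimately have A: "?A \<in> sets (obs_filtration M (enat (k + m)))" by (simp only:)
      have "?B = {\<omega> \<in> space (Pinf M). d \<omega> = i \<and> T \<omega> < \<infinity>} - {\<omega> \<in> space (Pinf M). T \<omega> \<le> enat k}"
        by (auto simp: not_le)
      moreover have "\<dots> \<in> sets (Pinf M)"
        by (intro sets.Diff rule_stop_event_Pinf[OF M R] rule_stopped_event_Pinf[OF M R, of "\<lambda>l. l = i"])
      ultimately have B: "?B \<in> sets (Pchg M (int k) j \<theta>')" by (simp only: Pj(2))
      have "?A \<subseteq> ?B"
      proof
        fix \<omega> assume "\<omega> \<in> ?A"
        then show "\<omega> \<in> ?B" by (cases "T \<omega>") auto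
      qed
      then have "measure (Pchg M (int k) j \<theta>') ?A * \<pi> (int k) \<le> \<pi> (int k) * measure (Pchg M (int k) j \<theta>') ?B"
        using pk Pj.finite_measure_mono[OF _ B] by (simp only: mult.commute[of _ "\<pi> (int k)"] mult_le_cancel_left_pos)
      also have "\<dots> \<le> \<beta> j i"
        using PMI_pair_ge[OF M \<pi> R j' \<theta>'(1) pmi] \<beta> by simp
      also have "\<beta> j i \<le> exp (- (real m * (J / s)))"
        by (rule le_exp_of_ln_bound[OF \<beta> s(1) m\<beta>[folded J_def]])
      finally have "measure (Pchg M (int k) j \<theta>') ?A * exp (- (- ln (\<pi> (int k)))) \<le> exp (- (real m * (J / s)))"
        using pk by (simp only: minus_minus exp_ln)
      then have "measure (Pchg M (int k) j \<theta>') ?A \<le> exp (- (real m * (J / s))) * exp (- ln (\<pi> (int k)))"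
        by (rule le_mult_expI)
      then have "exp ((?I + \<rho>) * real m) * measure (Pchg M (int k) j \<theta>') ?A
          \<le> exp ((?I + \<rho>) * real m) * (exp (- (real m * (J / s))) * exp (- ln (\<pi> (int k))))"
        by (intro mult_left_mono) auto
      also have "\<dots> \<le> exp (- ln (\<pi> (int k)) - \<rho> * real m)"
      proof -
        have Js: "J / s = J + 3 * \<rho>" by (rule eq_add_three_times_third[OF \<rho>_def])
        have "?I * real m \<le> (J + \<rho>) * real m" using \<theta>'(2) by (intro mult_right_mono) auto
        then show ?thesis unfolding exp_add[symmetric] Js exp_le_cancel_iff by (simp add: algebra_simps)
      qed
      finally have "exp ((?I + \<rho>) * real m) * measure (Pchg M (int k) j \<theta>') ?A
          \<le> exp (- ln (\<pi> (int k)) - \<rho> * real m)" .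
      moreover have "measure (Pchg M (int k) i \<theta>) ?A
          \<le> exp ((?I + \<rho>) * real m) * measure (Pchg M (int k) j \<theta>') ?A + ?C m"
        by (rule Pchg_le_Pchg[OF M i \<theta> j \<theta>'(1) elim(2) A])
      ultimately show "measure (Pchg M (int k) i \<theta>) ?A \<le> \<eta>" using elim(1) by linarith
    qed
  qed
qed

section \<open>The asymptotic lower bounds\<close>

text \<open>
  All that is used of the two limits is that, for every \<open>a > 0\<close>, the error bounds eventually satisfy
  this condition; this puts both problems in one form.
\<close>

definition small_errors :: "nat \<Rightarrow> real \<Rightarrow> (nat \<Rightarrow> real) \<Rightarrow> (nat \<Rightarrow> nat \<Rightarrow> real) \<Rightarrow> bool" where
  "small_errors N a \<alpha> \<beta> \<longleftrightarrow>
     (\<forall>j \<in> {1..N}. 0 < \<alpha> j \<and> \<alpha> j < 1 \<and> \<alpha> j < a) \<and>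
     (\<forall>j \<in> {1..N}. \<forall>l \<in> {1..N} - {j}. 0 < \<beta> j l \<and> \<beta> j l < 1 \<and> \<beta> j l < a)"

lemma eventually_err_filter:
  assumes "0 < a"
  shows "\<forall>\<^sub>F x in err_filter N. small_errors N a (fst x) (snd x)"
proof -
  have "\<forall>\<^sub>F y in nhds (0 :: real, 0 :: real). y \<in> {..<a} \<times> {..<a}"
    using assms by (intro eventually_nhds_in_open open_Times) auto
  then have "\<forall>\<^sub>F x in filtercomap (\<lambda>(\<alpha>, \<beta>). (MAX i \<in> {1..N}. \<alpha> i :: real,
      MAX (i, j) \<in> {1..N} \<times> {1..N} - Id. \<beta> i j :: real)) (nhds (0, 0)).
      (MAX i \<in> {1..N}. fst x i) < a \<and> (MAX (i, j) \<in> {1..N} \<times> {1..N} - Id. snd x i j) < a"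
    by (rule eventually_filtercomapI[THEN eventually_mono]) auto
  then show ?thesis
    unfolding err_filter_def eventually_inf_principal
  proof (rule eventually_mono, intro impI)
    fix x :: "(nat \<Rightarrow> real) \<times> (nat \<Rightarrow> nat \<Rightarrow> real)"
    assume max: "(MAX i \<in> {1..N}. fst x i) < a \<and> (MAX (i, j) \<in> {1..N} \<times> {1..N} - Id. snd x i j) < a"
      and pos: "x \<in> {(\<alpha>, \<beta>). (\<forall>i \<in> {1..N}. \<alpha> i \<in> {0<..<1}) \<and>
                             (\<forall>i \<in> {1..N}. \<forall>j \<in> {1..N} - {i}. \<beta> i j \<in> {0<..<1})}"
    have "fst x j < a" if "j \<in> {1..N}" for j
    proof -
      have "fst x j \<le> (MAX i \<in> {1..N}. fst x i)" using that by (intro Max_ge) auto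
      then show ?thesis using max by simp
    qed
    moreover have "snd x j l < a" if "j \<in> {1..N}" "l \<in> {1..N} - {j}" for j l
    proof -
      have "snd x j l \<in> (\<lambda>(i, j). snd x i j) ` ({1..N} \<times> {1..N} - Id)"
        using that by (intro image_eqI[of _ _ "(j, l)"]) auto
      then have "snd x j l \<le> (MAX (i, j) \<in> {1..N} \<times> {1..N} - Id. snd x i j)"
        by (intro Max_ge) auto
      then show ?thesis using max by simp
    qed
    ultimately show "small_errors N a (fst x) (snd x)"
      using pos by (auto simp: small_errors_def case_prod_beta)
  qed
qed

lemma eventually_err_filter_star:
  assumes "0 < a"
  shows "\<forall>\<^sub>F x in err_filter_star N. small_errors N a (\<lambda>_. fst x) (\<lambda>i _. snd x i)"
proof -
  have "\<forall>\<^sub>F y in nhds (0 :: real, 0 :: real). y \<in> {..<a} \<times> {..<a}"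
    using assms by (intro eventually_nhds_in_open open_Times) auto
  then have "\<forall>\<^sub>F x in filtercomap (\<lambda>(\<alpha> :: real, \<beta>). (\<alpha>, MAX i \<in> {1..N}. \<beta> i :: real)) (nhds (0, 0)).
      fst x < a \<and> (MAX i \<in> {1..N}. snd x i) < a"
    by (rule eventually_filtercomapI[THEN eventually_mono]) auto
  then show ?thesis
    unfolding err_filter_star_def eventually_inf_principal
  proof (rule eventually_mono, intro impI)
    fix x :: "real \<times> (nat \<Rightarrow> real)"
    assume max: "fst x < a \<and> (MAX i \<in> {1..N}. snd x i) < a"
      and pos: "x \<in> {(\<alpha>, \<beta>). \<alpha> \<in> {0<..<1} \<and> (\<forall>i \<in> {1..N}. \<beta> i \<in> {0<..<1})}"
    have "snd x j < a" if "j \<in> {1..N}" for j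
    proof -
      have "snd x j \<le> (MAX i \<in> {1..N}. snd x i)" using that by (intro Max_ge) auto
      then show ?thesis using max by simp
    qed
    then show "small_errors N a (\<lambda>_. fst x) (\<lambda>i _. snd x i)"
      using pos max by (auto simp: small_errors_def case_prod_beta)
  qed
qed

text \<open>
  The constant \<open>c\<close> is split evenly: \<open>s\<close> is chosen with \<open>s\<^sup>r = sqrt c\<close>, for the length of the
  delay, and \<open>\<eta>\<close> with \<open>1 - 3 \<eta> = sqrt c\<close>, for the probability of the three exceptional events.
\<close>

lemma eventually_delay_moment_ge:
  assumes M: "multistream_model M" and \<mu>: "0 \<le> \<mu>" and prior: "\<pi> \<in> prior_class \<mu>"
    and C1: "condition_C1 M I0 I" and i: "i \<in> {1..streams M}" and \<theta>: "\<theta> \<in> param M i"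
    and r: "0 < r" and I0: "0 < I0 i \<theta>"
    and Ipos: "\<And>j \<theta>'. j \<in> {1..streams M} - {i} \<Longrightarrow> \<theta>' \<in> param M j \<Longrightarrow> 0 < I i j \<theta> \<theta>'"
    and Iinf: "\<And>j. j \<in> {1..streams M} - {i} \<Longrightarrow> 0 < (INF \<theta>' \<in> param M j. I i j \<theta> \<theta>')"
    and small: "\<And>a. 0 < a \<Longrightarrow> \<forall>\<^sub>F x in F. small_errors (streams M) a (A x) (B x)"
    and c: "0 < c" "c < 1"
  shows "\<forall>\<^sub>F x in F. 0 < Psi M I0 I \<mu> i \<theta> (A x) (B x) \<and>
    (\<forall>\<delta> \<in> rule_class M \<pi> (A x) (B x).
       ennreal (c * Psi M I0 I \<mu> i \<theta> (A x) (B x) powr r) \<le> delay_moment M r (int k) i \<theta> \<delta>)"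
proof -
  have \<pi>: "change_prior \<pi>" using prior by (simp add: prior_class_def)
  have pk: "0 < \<pi> (int k)" by (rule prior_facts(2)[OF \<pi>])
  let ?N = "streams M" and ?S = "{1..streams M} - {i}" and ?J = "I0 i \<theta> + \<mu>"
  let ?Jj = "\<lambda>j. INF \<theta>' \<in> param M j. I i j \<theta> \<theta>'"
  have N: "2 \<le> ?N" using M by (simp add: multistream_model_def)
  have S: "?S \<noteq> {}"
  proof -
    have "card ?S = ?N - 1" using i by simp
    then show ?thesis using N by (metis card.empty diff_is_0_eq not_less_eq_eq numeral_2_eq_2 One_nat_def)
  qed
  define s where "s = sqrt c powr (1 / r)"
  define \<eta> where "\<eta> = (1 - sqrt c) / 3"
  have s: "0 < s" "s < 1" using c r powr_less_mono2[of "1 / r" "sqrt c" 1] by (auto simp: s_def)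
  have sr: "s powr r = sqrt c" using c r by (simp add: s_def powr_powr)
  have \<eta>: "0 < \<eta>" using c by (simp add: \<eta>_def)
  have J: "0 < ?J" using I0 \<mu> by simp
  define PA where "PA m \<longleftrightarrow> (\<forall>\<alpha> \<beta> d T. (d, T) \<in> rule_class M \<pi> \<alpha> \<beta> \<longrightarrow> 0 < \<alpha> i \<longrightarrow> \<alpha> i < 1 \<longrightarrow>
     real m * ?J \<le> s * \<bar>ln (\<alpha> i)\<bar> \<longrightarrow>
     measure (Pchg M (int k) i \<theta>) {\<omega> \<in> space (Pinf M). T \<omega> \<le> enat (k + m) \<and> d \<omega> = i} \<le> \<eta>)" for m
  define PB where "PB m j \<longleftrightarrow> (\<forall>\<alpha> \<beta> d T. (d, T) \<in> rule_class M \<pi> \<alpha> \<beta> \<longrightarrow> 0 < \<beta> j i \<longrightarrow> \<beta> j i < 1 \<longrightarrow>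
     real m * ?Jj j \<le> s * \<bar>ln (\<beta> j i)\<bar> \<longrightarrow>
     measure (Pchg M (int k) i \<theta>)
       {\<omega> \<in> space (Pinf M). (T \<omega> \<le> enat (k + m) \<and> d \<omega> = i) \<and> enat k < T \<omega>} \<le> \<eta>)" for m j
  have "eventually PA sequentially"
    unfolding PA_def[abs_def]
    by (rule eventually_early_alarm_small_by_PFA[OF M \<mu> prior C1 i \<theta> I0 s \<eta>])
  moreover have "\<forall>\<^sub>F m in sequentially. \<forall>j \<in> ?S. PB m j"
    unfolding PB_def[abs_def]
    by (intro eventually_ball_finite ballI eventually_early_alarm_small_by_PMI[OF M \<pi> C1 i \<theta> _ _ _ s \<eta>]
        Ipos Iinf) auto
  ultimately have "\<forall>\<^sub>F m in sequentially. PA m \<and> (\<forall>j \<in> ?S. PB m j)"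
    by (rule eventually_conj)
  then obtain m0 where PA: "\<And>m. m0 \<le> m \<Longrightarrow> PA m" and PB: "\<And>m j. m0 \<le> m \<Longrightarrow> j \<in> ?S \<Longrightarrow> PB m j"
    unfolding eventually_sequentially by blast
  \<comment> \<open>The first bound on the errors makes alarms by time \<open>k\<close> and wrong decisions improbable; the second
    one ensures \<open>s Psi \<ge> m0 + 1\<close>, so that \<open>\<lfloor>s Psi\<rfloor> \<ge> m0\<close>.\<close>
  define a where "a = min (\<eta> * \<pi> (int k) / real ?N) (exp (- (real (m0 + 1) * (?J / s))))"
  have a: "0 < a" using \<eta> pk N by (simp add: a_def)
  have Na: "real n * (a / \<pi> (int k)) \<le> \<eta>" if "n \<le> ?N" for n
  proof -
    have "real n * (a / \<pi> (int k)) \<le> real ?N * (a / \<pi> (int k))"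
      using that a pk by (intro mult_right_mono) auto
    also have "a \<le> \<eta> * \<pi> (int k) / real ?N" by (simp add: a_def)
    then have "real ?N * (a / \<pi> (int k)) \<le> \<eta>" using pk N by (simp add: field_simps)
    finally show ?thesis .
  qed
  show ?thesis
    using small[OF a]
  proof eventually_elim
    case (elim x)
    let ?\<alpha> = "A x" and ?\<beta> = "B x"
    let ?\<Psi> = "Psi M I0 I \<mu> i \<theta> ?\<alpha> ?\<beta>"
    have \<alpha>: "0 < ?\<alpha> j" "?\<alpha> j < 1" "?\<alpha> j < a" if "j \<in> {1..?N}" for j
      using elim that unfolding small_errors_def by blast+
    have \<beta>: "0 < ?\<beta> j l" "?\<beta> j l < 1" "?\<beta> j l < a" if "j \<in> {1..?N}" "l \<in> {1..?N} - {j}" for j l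
      using elim that unfolding small_errors_def by blast+
    have "?\<alpha> i < exp (- (real (m0 + 1) * (?J / s)))" using \<alpha>(3)[OF i] by (simp add: a_def)
    then have "ln (?\<alpha> i) < - (real (m0 + 1) * (?J / s))"
      using \<alpha>(1)[OF i] by (metis exp_less_cancel_iff exp_ln)
    then have "real (m0 + 1) * (?J / s) \<le> \<bar>ln (?\<alpha> i)\<bar>" by linarith
    then have "real (m0 + 1) \<le> s * (\<bar>ln (?\<alpha> i)\<bar> / ?J)" using J s by (simp add: field_simps)
    also have "\<dots> \<le> s * ?\<Psi>" using s by (intro mult_left_mono) (auto simp: Psi_def)
    finally have m0: "real (m0 + 1) \<le> s * ?\<Psi>" .
    then have "0 < s * ?\<Psi>" by (rule less_le_trans[rotated]) simp
    then have \<Psi>: "0 < ?\<Psi>" using s by (simp add: zero_less_mult_iff)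
    define m where "m = nat \<lfloor>s * ?\<Psi>\<rfloor>"
    have m: "real m \<le> s * ?\<Psi>" "s * ?\<Psi> \<le> real (m + 1)" "m0 \<le> m"
      using m0 unfolding m_def by linarith+
    have "ennreal (c * ?\<Psi> powr r) \<le> delay_moment M r (int k) i \<theta> \<delta>"
      if "\<delta> \<in> rule_class M \<pi> ?\<alpha> ?\<beta>" for \<delta>
    proof -
      obtain d T where \<delta>: "\<delta> = (d, T)" by (cases \<delta>)
      have cls: "(d, T) \<in> rule_class M \<pi> ?\<alpha> ?\<beta>" using that \<delta> by simp
      then have R: "(d, T) \<in> rules M"
        and pfa: "\<And>j. j \<in> {1..?N} \<Longrightarrow> PFA_stream M \<pi> j (d, T) \<le> ?\<alpha> j"
        and pmi: "\<And>j. j \<in> ?S \<Longrightarrow> PMI_pair M \<pi> i j (d, T) \<le> ?\<beta> i j"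
        using i by (auto simp: rule_class_def)
      interpret Pinf: prob_space "Pinf M" by (rule model_Pinf(1)[OF M])
      interpret P: prob_space "Pchg M (int k) i \<theta>" by (rule model_Pchg(1)[OF M i \<theta>])
      let ?P = "measure (Pchg M (int k) i \<theta>)"
      let ?E = "\<lambda>j. {\<omega> \<in> space (Pinf M). T \<omega> \<le> enat k \<and> d \<omega> = j}"
      let ?D = "{\<omega> \<in> space (Pinf M). T \<omega> \<le> enat (k + m) \<and> d \<omega> = i}"
      let ?H = "{\<omega> \<in> space (Pinf M). (T \<omega> \<le> enat (k + m) \<and> d \<omega> = i) \<and> enat k < T \<omega>}"
      have ev: "{\<omega> \<in> space (Pinf M). T \<omega> \<le> enat n \<and> d \<omega> = j} \<in> sets (Pinf M)" for n j
        using rule_decision_event[OF R] sets_obs_filtration(2)[OF M] by blast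
      have "{\<omega> \<in> space (Pinf M). T \<omega> \<le> enat k} = (\<Union>j \<in> {1..?N}. ?E j)"
        using R by (auto simp: rules_def)
      then have "measure (Pinf M) {\<omega> \<in> space (Pinf M). T \<omega> \<le> enat k} \<le> (\<Sum>j \<in> {1..?N}. measure (Pinf M) (?E j))"
        using ev by (simp only:) (intro Pinf.finite_measure_subadditive_finite, auto)
      also have "\<dots> \<le> of_nat (card {1..?N}) * (a / \<pi> (int k))"
      proof (rule sum_bounded_above)
        fix j assume j: "j \<in> {1..?N}"
        have "\<pi> (int k) * measure (Pinf M) (?E j) \<le> PFA_stream M \<pi> j (d, T)"
          by (rule PFA_stream_ge(1)[OF M \<pi> R])
        also have "\<dots> \<le> a" using pfa[OF j] \<alpha>(3)[OF j] by simp
        finally show "measure (Pinf M) (?E j) \<le> a / \<pi> (int k)" using pk by (simp add: pos_le_divide_eq mult.commute)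
      qed
      also have "\<dots> \<le> \<eta>" by (rule Na) simp
      finally have 1: "measure (Pinf M) {\<omega> \<in> space (Pinf M). T \<omega> \<le> enat k} \<le> \<eta>" .
      have "(\<Sum>j \<in> ?S. ?P {\<omega> \<in> space (Pinf M). d \<omega> = j \<and> T \<omega> < \<infinity> \<and> enat k < T \<omega>})
          \<le> of_nat (card ?S) * (a / \<pi> (int k))"
      proof (rule sum_bounded_above)
        fix j assume j: "j \<in> ?S"
        have "\<pi> (int k) * ?P {\<omega> \<in> space (Pinf M). d \<omega> = j \<and> T \<omega> < \<infinity> \<and> enat k < T \<omega>} \<le> ?\<beta> i j"
          using \<beta>(1)[OF i j] by (intro PMI_pair_ge[OF M \<pi> R i \<theta> pmi[OF j]]) simp
        also have "\<dots> \<le> a" using \<beta>(3)[OF i j] by simp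
        finally show "?P {\<omega> \<in> space (Pinf M). d \<omega> = j \<and> T \<omega> < \<infinity> \<and> enat k < T \<omega>} \<le> a / \<pi> (int k)"
          using pk by (simp add: pos_le_divide_eq mult.commute)
      qed
      also have "\<dots> \<le> \<eta>" by (rule Na) (simp add: card_Diff_subset_Int le_diff_conv)
      finally have 2: "(\<Sum>j \<in> ?S. ?P {\<omega> \<in> space (Pinf M). d \<omega> = j \<and> T \<omega> < \<infinity> \<and> enat k < T \<omega>}) \<le> \<eta>" .
      \<comment> \<open>The term that attains the maximum in \<open>Psi\<close> decides which competitor is used.\<close>
      have 3: "?P ?H \<le> \<eta>"
      proof (cases "?\<Psi> = \<bar>ln (?\<alpha> i)\<bar> / ?J")
        case True
        then have "real m * ?J \<le> s * \<bar>ln (?\<alpha> i)\<bar>" using m(1) J by (simp add: pos_le_divide_eq)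
        then have "?P ?D \<le> \<eta>" using PA[OF m(3)] cls \<alpha>[OF i] unfolding PA_def by blast
        moreover have "?P ?H \<le> ?P ?D"
          using ev by (intro P.finite_measure_mono) (auto simp: model_Pchg(2)[OF M i \<theta>])
        ultimately show ?thesis by simp
      next
        case False
        then have "?\<Psi> = (MAX j \<in> ?S. \<bar>ln (?\<beta> j i)\<bar> / ?Jj j)"
          unfolding Psi_def by (auto simp: max_def split: if_splits)
        moreover have "(MAX j \<in> ?S. \<bar>ln (?\<beta> j i)\<bar> / ?Jj j) \<in> (\<lambda>j. \<bar>ln (?\<beta> j i)\<bar> / ?Jj j) ` ?S"
          using S by (intro Max_in) auto
        ultimately have "?\<Psi> \<in> (\<lambda>j. \<bar>ln (?\<beta> j i)\<bar> / ?Jj j) ` ?S" by (simp only:)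
        then obtain j where j: "j \<in> ?S" and eq: "?\<Psi> = \<bar>ln (?\<beta> j i)\<bar> / ?Jj j" by blast
        have ji: "j \<in> {1..?N}" "i \<in> {1..?N} - {j}" using i j by auto
        have "real m * ?Jj j \<le> s * \<bar>ln (?\<beta> j i)\<bar>"
          using m(1) Iinf[OF j] unfolding eq by (simp add: pos_le_divide_eq)
        then show ?thesis using PB[OF m(3) j] cls \<beta>[OF ji] unfolding PB_def by blast
      qed
      have "c * ?\<Psi> powr r = (s * ?\<Psi>) powr r * sqrt c"
        using s \<Psi> c by (simp add: powr_mult sr)
      also have "\<dots> \<le> real (m + 1) powr r * sqrt c"
        using m(2) s \<Psi> r c by (intro mult_right_mono powr_mono2) auto
      also have "\<dots> \<le> real (m + 1) powr r
        * (1 - measure (Pinf M) {\<omega> \<in> space (Pinf M). T \<omega> \<le> enat k}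
           - (\<Sum>j \<in> ?S. ?P {\<omega> \<in> space (Pinf M). d \<omega> = j \<and> T \<omega> < \<infinity> \<and> enat k < T \<omega>})
           - ?P ?H)"
      proof (rule mult_left_mono)
        have "sqrt c = 1 - \<eta> - \<eta> - \<eta>" using eq_add_three_times_third[OF \<eta>_def] by linarith
        also have "\<dots> \<le> 1 - measure (Pinf M) {\<omega> \<in> space (Pinf M). T \<omega> \<le> enat k}
           - (\<Sum>j \<in> ?S. ?P {\<omega> \<in> space (Pinf M). d \<omega> = j \<and> T \<omega> < \<infinity> \<and> enat k < T \<omega>})
           - ?P ?H"
          using 1 2 3 by (intro diff_mono) auto
        finally show "sqrt c \<le> 1 - measure (Pinf M) {\<omega> \<in> space (Pinf M). T \<omega> \<le> enat k}
           - (\<Sum>j \<in> ?S. ?P {\<omega> \<in> space (Pinf M). d \<omega> = j \<and> T \<omega> < \<infinity> \<and> enat k < T \<omega>})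
           - ?P ?H" .
      qed simp
      finally have "ennreal (c * ?\<Psi> powr r) \<le> ennreal (real (m + 1) powr r
        * (1 - measure (Pinf M) {\<omega> \<in> space (Pinf M). T \<omega> \<le> enat k}
           - (\<Sum>j \<in> ?S. ?P {\<omega> \<in> space (Pinf M). d \<omega> = j \<and> T \<omega> < \<infinity> \<and> enat k < T \<omega>})
           - ?P ?H))" by (rule ennreal_leI)
      also have "\<dots> \<le> delay_moment M r (int k) i \<theta> (d, T)"
        by (rule delay_moment_ge[OF M R i \<theta> r])
      finally show ?thesis by (simp only: \<delta>)
    qed
    then show ?case using \<Psi> by blast
  qed
qed

lemma delay_moment_minus_one_ge:
  assumes M: "multistream_model M" and i: "i \<in> {1..streams M}" and \<theta>: "\<theta> \<in> param M i"
  shows "delay_moment M r 0 i \<theta> \<delta> \<le> delay_moment M r (-1) i \<theta> \<delta>"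
proof (cases \<delta>)
  case (Pair d T)
  have "delay_loss r 0 i (d \<omega>) (T \<omega>) * indicator {\<omega>. stops_after (T \<omega>) 0} \<omega>
    \<le> delay_loss r (-1) i (d \<omega>) (T \<omega>) * indicator {\<omega>. stops_after (T \<omega>) (-1)} \<omega>" for \<omega>
    by (auto simp: delay_loss_def indicator_def split: enat.split)
  then show ?thesis
    unfolding Pair delay_moment_def prod.case model_Pchg(5)[OF M i \<theta>] by (intro nn_integral_mono)
qed

lemma ennreal_le_divide_le_one:
  assumes "y \<le> 1" shows "x \<le> x / ennreal y"
proof (cases "0 < y")
  case True
  then have "1 \<le> inverse (ennreal y)"
    using assms by (simp add: inverse_ennreal one_le_inverse ennreal_1[symmetric] del: ennreal_1)
  then show ?thesis
    unfolding divide_ennreal_def using mult_left_mono[of 1 "inverse (ennreal y)" x] by simp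
next
  case False
  then show ?thesis by (simp add: ennreal_neg)
qed

text \<open>
  \<open>\<Psi> x > 0\<close> is essential: a vanishing denominator would turn the quotient into \<open>0 / 0 = 0\<close> when the
  infimum vanishes.
\<close>

lemma one_le_Liminf_Inf_ratio:
  fixes R :: "'d \<Rightarrow> ennreal" and \<Psi> :: "'x \<Rightarrow> real"
  assumes "\<And>c. 0 < c \<Longrightarrow> c < 1 \<Longrightarrow>
    \<forall>\<^sub>F x in F. 0 < \<Psi> x \<and> (\<forall>\<delta> \<in> K x. ennreal (c * \<Psi> x powr r) \<le> R \<delta>)"
  shows "1 \<le> Liminf F (\<lambda>x. (INF \<delta> \<in> K x. R \<delta>) / ennreal (\<Psi> x powr r))"
proof (subst le_Liminf_iff, intro allI impI)
  fix y :: ennreal assume "y < 1"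
  then obtain c' where c': "y < c'" "c' < 1" using dense by blast
  then obtain c where c: "c' = ennreal c" "0 \<le> c" by (cases c') auto
  have "c < 1" using c c' by (simp add: ennreal_1[symmetric] ennreal_less_iff del: ennreal_1)
  moreover have "0 < c" using c c' by (auto simp: less_le)
  ultimately have "\<forall>\<^sub>F x in F. 0 < \<Psi> x \<and> (\<forall>\<delta> \<in> K x. ennreal (c * \<Psi> x powr r) \<le> R \<delta>)"
    using assms by blast
  then show "\<forall>\<^sub>F x in F. y < (INF \<delta> \<in> K x. R \<delta>) / ennreal (\<Psi> x powr r)"
  proof eventually_elim
    case (elim x)
    have "ennreal c = ennreal (c * \<Psi> x powr r) / ennreal (\<Psi> x powr r)"
      using elim c by (subst divide_ennreal) auto
    also have "\<dots> \<le> (INF \<delta> \<in> K x. R \<delta>) / ennreal (\<Psi> x powr r)"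
      using elim by (intro divide_right_mono_ennreal INF_greatest) auto
    finally show ?case using c c' by simp
  qed
qed

lemma finite_sum_le_infsum_ennreal:
  fixes f :: "'a \<Rightarrow> ennreal"
  assumes "finite X" "X \<subseteq> A"
  shows "sum f X \<le> infsum f A"
proof -
  have "infsum f X \<le> infsum f A"
    using assms by (intro infsum_mono_neutral nonneg_summable_on_complete) auto
  then show ?thesis using assms(1) by simp
qed

text \<open>
  Both risks are at least the unconditional moments, since they divide by a probability at most \<open>1\<close>.  For the
  averaged risk, a finite set \<open>X\<close> of change points of prior mass above \<open>sqrt c\<close> suffices, because a
  finite intersection of eventual properties is eventual.
\<close>

lemma risk_bounds:
  fixes M :: "('w, 'a, 'p) multistream" and F :: "'x filter"
  assumes M: "multistream_model M" and \<mu>: "0 \<le> \<mu>" and prior: "\<pi> \<in> prior_class \<mu>"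
    and C1: "condition_C1 M I0 I" and i: "i \<in> {1..streams M}" and \<theta>: "\<theta> \<in> param M i"
    and r: "0 < r" and I0: "0 < I0 i \<theta>"
    and Ipos: "\<And>j \<theta>'. j \<in> {1..streams M} - {i} \<Longrightarrow> \<theta>' \<in> param M j \<Longrightarrow> 0 < I i j \<theta> \<theta>'"
    and Iinf: "\<And>j. j \<in> {1..streams M} - {i} \<Longrightarrow> 0 < (INF \<theta>' \<in> param M j. I i j \<theta> \<theta>')"
    and small: "\<And>a. 0 < a \<Longrightarrow> \<forall>\<^sub>F x in F. small_errors (streams M) a (A x) (B x)"
    and K: "\<And>x. K x \<subseteq> rule_class M \<pi> (A x) (B x)"
  shows "-1 \<le> k \<Longrightarrow> 1 \<le> Liminf F (\<lambda>x. (INF \<delta> \<in> K x. risk M r k i \<theta> \<delta>)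
      / ennreal (Psi M I0 I \<mu> i \<theta> (A x) (B x) powr r))"
    and "1 \<le> Liminf F (\<lambda>x. (INF \<delta> \<in> K x. avg_risk M \<pi> r i \<theta> \<delta>)
      / ennreal (Psi M I0 I \<mu> i \<theta> (A x) (B x) powr r))"
proof -
  have \<pi>: "change_prior \<pi>" using prior by (simp add: prior_class_def)
  let ?\<Psi> = "\<lambda>x. Psi M I0 I \<mu> i \<theta> (A x) (B x)"
  have dm: "\<forall>\<^sub>F x in F. 0 < ?\<Psi> x \<and> (\<forall>\<delta> \<in> K x. ennreal (c * ?\<Psi> x powr r) \<le> delay_moment M r k i \<theta> \<delta>)"
    if "-1 \<le> k" "0 < c" "c < 1" for k c
  proof -
    have "\<forall>\<^sub>F x in F. 0 < ?\<Psi> x \<and> (\<forall>\<delta> \<in> rule_class M \<pi> (A x) (B x).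
        ennreal (c * ?\<Psi> x powr r) \<le> delay_moment M r (int (nat k)) i \<theta> \<delta>)"
      using Ipos Iinf small that by (intro eventually_delay_moment_ge[OF M \<mu> prior C1 i \<theta> r I0]) auto
    moreover have "delay_moment M r (int (nat k)) i \<theta> \<delta> \<le> delay_moment M r k i \<theta> \<delta>" for \<delta>
      using that(1) delay_moment_minus_one_ge[OF M i \<theta>, of r \<delta>] by (cases "k = -1") auto
    ultimately show ?thesis
      using K by (elim eventually_mono) (blast intro: order_trans)
  qed
  show "1 \<le> Liminf F (\<lambda>x. (INF \<delta> \<in> K x. risk M r k i \<theta> \<delta>) / ennreal (?\<Psi> x powr r))" if k: "-1 \<le> k"
  proof (rule one_le_Liminf_Inf_ratio)
    fix c :: real assume c: "0 < c" "c < 1"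
    have "delay_moment M r k i \<theta> \<delta> \<le> risk M r k i \<theta> \<delta>" for \<delta>
      unfolding risk_def case_prod_beta prod.collapse
      by (intro ennreal_le_divide_le_one prob_space.prob_le_1 model_Pchg_from_minus_one(1)[OF M i \<theta> k])
    then show "\<forall>\<^sub>F x in F. 0 < ?\<Psi> x \<and> (\<forall>\<delta> \<in> K x. ennreal (c * ?\<Psi> x powr r) \<le> risk M r k i \<theta> \<delta>)"
      using dm[OF k c] by (elim eventually_mono) (blast intro: order_trans)
  qed
  show "1 \<le> Liminf F (\<lambda>x. (INF \<delta> \<in> K x. avg_risk M \<pi> r i \<theta> \<delta>) / ennreal (?\<Psi> x powr r))"
  proof (rule one_le_Liminf_Inf_ratio)
    fix c :: real assume c: "0 < c" "c < 1"
    have "(\<pi> has_sum 1) {-1..}" using \<pi> by (simp add: change_prior_def)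
    then have "\<forall>\<^sub>F X in finite_subsets_at_top {-1..}. sqrt c < sum \<pi> X"
      unfolding has_sum_def using c by (intro order_tendstoD) auto
    then obtain X where X: "finite X" "X \<subseteq> {-1..}" "sqrt c < sum \<pi> X"
      unfolding eventually_finite_subsets_at_top by blast
    have \<pi>X: "0 \<le> \<pi> k" if "k \<in> X" for k using X(2) that prior_facts(1)[OF \<pi>] by auto
    have "\<forall>\<^sub>F x in F. \<forall>k \<in> insert 0 X. 0 < ?\<Psi> x \<and>
        (\<forall>\<delta> \<in> K x. ennreal (sqrt c * ?\<Psi> x powr r) \<le> delay_moment M r k i \<theta> \<delta>)"
      using X c by (intro eventually_ball_finite ballI dm) auto
    then show "\<forall>\<^sub>F x in F. 0 < ?\<Psi> x \<and> (\<forall>\<delta> \<in> K x. ennreal (c * ?\<Psi> x powr r) \<le> avg_risk M \<pi> r i \<theta> \<delta>)"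
    proof (elim eventually_mono, intro conjI ballI)
      fix x \<delta>
      assume *: "\<forall>k \<in> insert 0 X. 0 < ?\<Psi> x \<and>
        (\<forall>\<delta> \<in> K x. ennreal (sqrt c * ?\<Psi> x powr r) \<le> delay_moment M r k i \<theta> \<delta>)"
      then show "0 < ?\<Psi> x" by blast
      assume \<delta>: "\<delta> \<in> K x"
      have "c * ?\<Psi> x powr r = sqrt c * (sqrt c * ?\<Psi> x powr r)" using c by simp
      also have "\<dots> \<le> sum \<pi> X * (sqrt c * ?\<Psi> x powr r)"
        using X(3) c by (intro mult_right_mono) auto
      finally have "ennreal (c * ?\<Psi> x powr r) \<le> ennreal (\<Sum>k\<in>X. \<pi> k * (sqrt c * ?\<Psi> x powr r))"
        by (simp add: sum_distrib_right ennreal_leI)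
      also have "\<dots> = (\<Sum>k\<in>X. ennreal (\<pi> k) * ennreal (sqrt c * ?\<Psi> x powr r))"
        using \<pi>X c by (simp flip: sum_ennreal ennreal_mult)
      also have "\<dots> \<le> (\<Sum>k\<in>X. ennreal (\<pi> k) * delay_moment M r k i \<theta> \<delta>)"
        using * \<delta> by (intro sum_mono mult_left_mono) auto
      also have "\<dots> \<le> (\<Sum>\<^sub>\<infinity>k \<in> {-1..}. ennreal (\<pi> k) * delay_moment M r k i \<theta> \<delta>)"
        by (rule finite_sum_le_infsum_ennreal[OF X(1,2)])
      also have "\<dots> \<le> avg_risk M \<pi> r i \<theta> \<delta>"
        unfolding avg_risk_def using PFA_nonneg[OF M \<pi>, of "fst \<delta>" "snd \<delta>"]
        by (intro ennreal_le_divide_le_one) simp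
      finally show "ennreal (c * ?\<Psi> x powr r) \<le> avg_risk M \<pi> r i \<theta> \<delta>" .
    qed
  qed
qed

theorem theorem2:
  fixes M :: "('w, 'a, 'p) multistream"
    and \<pi> :: "int \<Rightarrow> real"
    and I0 :: "nat \<Rightarrow> 'p \<Rightarrow> real"
    and I :: "nat \<Rightarrow> nat \<Rightarrow> 'p \<Rightarrow> 'p \<Rightarrow> real"
    and \<mu> r :: real and i :: nat and \<theta> :: 'p
  assumes "multistream_model M"
    and "0 \<le> \<mu>" and "\<pi> \<in> prior_class \<mu>"
    and "\<And>i \<theta>. i \<in> {1..streams M} \<Longrightarrow> \<theta> \<in> param M i \<Longrightarrow> 0 < I0 i \<theta>"
    and "\<And>i j \<theta> \<theta>'. i \<in> {1..streams M} \<Longrightarrow> j \<in> {1..streams M} - {i} \<Longrightarrow>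
           \<theta> \<in> param M i \<Longrightarrow> \<theta>' \<in> param M j \<Longrightarrow> 0 < I i j \<theta> \<theta>'"
    and "condition_C1 M I0 I"
    and "i \<in> {1..streams M}" and "\<theta> \<in> param M i" and "0 < r"
    and "\<And>j. j \<in> {1..streams M} - {i} \<Longrightarrow> 0 < (INF \<theta>' \<in> param M j. I i j \<theta> \<theta>')"
  shows "(\<forall>k \<ge> -1. 1 \<le> Liminf (err_filter (streams M))
            (\<lambda>(\<alpha>, \<beta>). (INF \<delta> \<in> rule_class M \<pi> \<alpha> \<beta>. risk M r k i \<theta> \<delta>)
                       / ennreal (Psi M I0 I \<mu> i \<theta> \<alpha> \<beta> powr r)))
       \<and> 1 \<le> Liminf (err_filter (streams M))
            (\<lambda>(\<alpha>, \<beta>). (INF \<delta> \<in> rule_class M \<pi> \<alpha> \<beta>. avg_risk M \<pi> r i \<theta> \<delta>)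
                       / ennreal (Psi M I0 I \<mu> i \<theta> \<alpha> \<beta> powr r))
       \<and> (\<forall>k \<ge> -1. 1 \<le> Liminf (err_filter_star (streams M))
            (\<lambda>(\<alpha>, \<beta>). (INF \<delta> \<in> rule_class_star M \<pi> \<alpha> \<beta>. risk M r k i \<theta> \<delta>)
                       / ennreal (Psi_star M I0 I \<mu> i \<theta> \<alpha> \<beta> powr r)))
       \<and> 1 \<le> Liminf (err_filter_star (streams M))
            (\<lambda>(\<alpha>, \<beta>). (INF \<delta> \<in> rule_class_star M \<pi> \<alpha> \<beta>. avg_risk M \<pi> r i \<theta> \<delta>)
                       / ennreal (Psi_star M I0 I \<mu> i \<theta> \<alpha> \<beta> powr r))"
proof -
  have \<pi>: "change_prior \<pi>" using assms(3) by (simp add: prior_class_def)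
  note pos = assms(4)[OF assms(7,8)] assms(5)[OF assms(7) _ assms(8)] assms(10)
  have Psi_star: "Psi_star M I0 I \<mu> i \<theta> \<alpha> \<beta> = Psi M I0 I \<mu> i \<theta> (\<lambda>_. \<alpha>) (\<lambda>i _. \<beta> i)" for \<alpha> \<beta>
    by (simp add: Psi_star_def Psi_def)
  note plain = risk_bounds[where F = "err_filter (streams M)" and A = fst and B = snd
      and K = "\<lambda>x. rule_class M \<pi> (fst x) (snd x)",
      OF assms(1-3,6-9) pos eventually_err_filter order_refl]
  note star = risk_bounds[where F = "err_filter_star (streams M)" and A = "\<lambda>x _. fst x"
      and B = "\<lambda>x i _. snd x i" and K = "\<lambda>x. rule_class_star M \<pi> (fst x) (snd x)",
      OF assms(1-3,6-9) pos eventually_err_filter_star rule_class_star_subset[OF assms(1) \<pi>]]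
  show ?thesis
    unfolding case_prod_beta Psi_star by (intro conjI allI impI plain star)
qed

end
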